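(* Let $n\ge 3$ be an integer, let $a_0,a_1,\dots,a_n$ be nonnegative integers, and let $Q_2$ be a subset of $\{(i,j)\mid 3\le i<j\le n\}$. Let $T=E\overline{Q_2}$ be the tournament on $\{1,\dots,n\}$ in which, for $1\le i<j\le n$, $i\to j$ if $(i,j)\notin Q_2$ and $j\to i$ if $(i,j)\in Q_2$. Then $$\mathop{\mathrm{CT}}_{\mathbf{x}}\ \frac{x_0}{x_2}\prod_{(i,j)\in Q_2}\frac{x_j}{x_i}\ D_n(\mathbf{x},\mathbf{a},q)=0$$ if $T$ is nontransitive, and if $T$ is transitive with winner permutation $\sigma$, then $$\mathop{\mathrm{CT}}_{\mathbf{x}}\ \frac{x_0}{x_2}\prod_{(i,j)\in Q_2}\frac{x_j}{x_i}\ D_n(\mathbf{x},\mathbf{a},q)=(-1)^{|Q_2|}\,\frac{(1+q^{a_{\sigma(1)}})(q^{a_{\sigma(2)}}-q^{a_{\sigma(3)}})}{1-q^{a_0+a_{\sigma(1)}+a_{\sigma(3)}}}\cdot\frac{(q)_{a_0+a_1+\cdots+a_n}}{(q)_{a_0}(q)_{a_1}\cdots(q)_{a_n}}\prod_{i=1}^{n}\frac{1-q^{a_i}}{1-q^{a_0+\sigma_i}},$$ where $\sigma_i=\sum_{k=1}^{i}a_{\sigma(k)}$.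
   Context: $q$ is an indeterminate, $K=\mathbb{C}(q)$, $\mathbf{x}=(x_0,\dots,x_n)$, $\mathbf{a}=(a_0,\dots,a_n)$. For an integer $k$, $(z)_k=(z;q)_\infty/(zq^k;q)_\infty$, i.e. $(z)_k=(1-z)(1-zq)\cdots(1-zq^{k-1})$ for $k\ge0$ and $(z)_k=1/\big((1-zq^k)\cdots(1-zq^{-1})\big)$ for $k<0$. The $q$-Dyson style product is $D_n(\mathbf{x},\mathbf{a},q)=\prod_{0\le i<j\le n}\left(\frac{x_i}{x_j}\right)_{a_i}\left(\frac{x_j}{x_i}q\right)_{a_j-1}$. All rational functions are expanded in the field of iterated Laurent series $K((x_n))((x_{n-1}))\cdots((x_0))$ (so $1/(1-cx_i/x_j)=\sum_{l\ge0}c^lx_i^lx_j^{-l}$ when $i<j$), and $\mathop{\mathrm{CT}}_{\mathbf{x}}$ is the constant term in all of $x_0,\dots,x_n$. $|Q_2|$ is the number of elements of $Q_2$. A tournament is transitive if it has no directed 3-cycle. For a transitive tournament $T$ on $\{1,\dots,n\}$, the winner permutation is the permutation $\sigma$ with $\sigma(1)\to\sigma(2)\to\cdots\to\sigma(n)$ in $T$. *)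

theory Defs
  imports "HOL-Computational_Algebra.Polynomial" "HOL-Computational_Algebra.Fraction_Field"
begin

type_synonym K = "complex poly fract"

definition qK :: K where
  "qK = Fract [:0, 1:] 1"

definition qfac :: "nat \<Rightarrow> K" where
  "qfac m = (\<Prod>k<m. 1 - qK ^ (k + 1))"

text \<open>An element is represented by its coefficient function: exponent vectors
  (nat \<Rightarrow> int, the exponent of x_k at k) to coefficients in K.
  Multiplication is the Cauchy product; for all elements of the iterated Laurent series
  field K((x_n))...((x_0)) occurring here the convolution sums are finite.\<close>

type_synonym lser = "(nat \<Rightarrow> int) \<Rightarrow> K"

definition lmul :: "lser \<Rightarrow> lser \<Rightarrow> lser" where
  "lmul f g = (\<lambda>e. \<Sum>d \<in> {d. f d \<noteq> 0 \<and> g (\<lambda>k. e k - d k) \<noteq> 0}. f d * g (\<lambda>k. e k - d k))"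

definition lone :: lser where
  "lone = (\<lambda>e. if e = (\<lambda>_. 0) then 1 else 0)"

definition lprod :: "lser list \<Rightarrow> lser" where
  "lprod fs = foldr lmul fs lone"

definition lmono :: "(nat \<Rightarrow> int) \<Rightarrow> lser" where
  "lmono e0 = (\<lambda>e. if e = e0 then 1 else 0)"

definition uvec :: "nat \<Rightarrow> nat \<Rightarrow> int" where
  "uvec i = (\<lambda>k. if k = i then 1 else 0)"

definition ratio :: "nat \<Rightarrow> nat \<Rightarrow> nat \<Rightarrow> int" where
  "ratio a b = (\<lambda>k. uvec a k - uvec b k)"

definition oneminus :: "K \<Rightarrow> nat \<Rightarrow> nat \<Rightarrow> lser" where
  "oneminus c a b = (\<lambda>e. (if e = (\<lambda>_. 0) then 1 else 0) - (if e = ratio a b then c else 0))"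

(* expansion of 1/(1 - c x_a/x_b) (a \<noteq> b, c \<noteq> 0) in K((x_n))...((x_0)):
   if a < b:  sum_{l>=0} c^l (x_a/x_b)^l;
   if a > b:  -(c x_a/x_b)^{-1}/(1 - c^{-1} x_b/x_a) = - sum_{l>=1} c^{-l} (x_b/x_a)^l *)
definition geominv :: "K \<Rightarrow> nat \<Rightarrow> nat \<Rightarrow> lser" where
  "geominv c a b = (\<lambda>e.
     if a < b then (\<Sum>l \<in> {l::nat. e = (\<lambda>k. int l * ratio a b k)}. c ^ l)
     else - (\<Sum>l \<in> {l::nat. 1 \<le> l \<and> e = (\<lambda>k. int l * ratio b a k)}. (inverse c) ^ l))"

definition qpoch :: "K \<Rightarrow> nat \<Rightarrow> nat \<Rightarrow> int \<Rightarrow> lser" where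
  "qpoch c a b k =
     (if 0 \<le> k then lprod (map (\<lambda>m. oneminus (c * qK ^ m) a b) [0..<nat k])
      else lprod (map (\<lambda>m. geominv (c * inverse qK ^ m) a b) [1..<nat (- k) + 1]))"

definition Dn :: "nat \<Rightarrow> (nat \<Rightarrow> nat) \<Rightarrow> lser" where
  "Dn n a = lprod (concat (map (\<lambda>j. concat (map (\<lambda>i.
       [qpoch 1 i j (int (a i)), qpoch qK j i (int (a j) - 1)]) [0..<j])) [0..<n+1]))"

definition CT :: "lser \<Rightarrow> K" where
  "CT f = f (\<lambda>_. 0)"

definition beats :: "(nat \<times> nat) set \<Rightarrow> nat \<Rightarrow> nat \<Rightarrow> bool" where
  "beats Q i j = ((i < j \<and> (i, j) \<notin> Q) \<or> (j < i \<and> (j, i) \<in> Q))"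

definition transitive_tourn :: "nat \<Rightarrow> (nat \<times> nat) set \<Rightarrow> bool" where
  "transitive_tourn n Q = (\<not> (\<exists>i\<in>{1..n}. \<exists>j\<in>{1..n}. \<exists>k\<in>{1..n}.
      beats Q i j \<and> beats Q j k \<and> beats Q k i))"

definition winner_perm :: "nat \<Rightarrow> (nat \<times> nat) set \<Rightarrow> (nat \<Rightarrow> nat) \<Rightarrow> bool" where
  "winner_perm n Q \<sigma> = (bij_betw \<sigma> {1..n} {1..n} \<and>
      (\<forall>k\<in>{1..<n}. beats Q (\<sigma> k) (\<sigma> (k + 1))))"

end

theory Submission
  imports Defs "HOL-Library.FuncSet"
begin

text \<open>Suppose first that \<open>a i \<ge> 1\<close> for \<open>i \<ge> 1\<close>, and let \<open>N\<close> be the sum of all \<open>a i\<close>. Clearing denominators, the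
  constant term is the coefficient of the product of the \<open>x i ^ (N - a i)\<close> in a polynomial of that total degree,
  namely a product of linear forms \<open>x j - q ^ m * x i\<close> times arbitrary monic polynomials \<open>\<psi> i (x i)\<close> of
  prescribed degrees \<open>w i\<close>. Lagrange interpolation on the grid \<open>x i = q ^ \<alpha> i\<close>, \<open>0 \<le> \<alpha> i \<le> N - a i\<close>, turns it
  into a sum over nodes, and a node contributes only if the intervals \<open>[\<alpha> i, \<alpha> i + a i)\<close> tile \<open>[0, N)\<close>, that is, if
  it comes from an order of \<open>{0, \<dots>, n}\<close>. As \<open>w i\<close> is, for \<open>i \<ge> 3\<close>, the number of players beaten by \<open>i\<close>, the roots
  of \<open>\<psi>\<close> can be chosen to force the last places of the order, removing one player after the other who loses to
  all the remaining ones. If the tournament is not transitive, a root is left over when this gets stuck and no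
  order survives; if it is transitive, exactly two orders survive, and their contributions are explicit
  products. If \<open>a k = 0\<close> for some \<open>k \<ge> 1\<close>, then for the largest such \<open>k\<close> all exponents of \<open>x k\<close> are negative and
  both sides vanish.\<close>

text \<open>The \<open>\<psi> i\<close> are free because the total degree is tight: a lower term of
  some \<open>\<psi> i\<close> lowers the total degree and never reaches the target monomial. Their
  degrees come from D_n, whose denominators in x_i stop n - i short of N - a i; adding the exponent
  of the monomial gives \<open>w i\<close>. A factor x_j / x_i moves one unit from i to j, exactly
  as reversing the match between i and j moves one win, and this is where the tournament enters.
  With \<open>\<psi> i\<close> a mere power of X, whose root 0 is not a node, no order would be
  killed; all the work lies in spending the roots well. In the transitive case, forcing the places 4
  to n costs n - 3 roots for each of 0, 1, 2, \<open>\<sigma> 3\<close>. Their degrees n + 1, n - 1,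
  n - 3, n - 3 leave four, two, none and none, enough to cut the 24 orders of the first four places
  down to two. With X, Y, Z the powers of q at the parameters of \<open>\<sigma> 1\<close>,
  \<open>\<sigma> 2\<close>, \<open>\<sigma> 3\<close>, the two contributions carry Y - X Z and Z -
  X Y with opposite signs, and the difference (1 + X) (Y - Z) is the numerator of the
  result.\<close>

lemma qK_power: "qK ^ m = Fract (monom 1 m) 1"
  by (induction m) (auto simp: qK_def One_fract_def monom_Suc mult_monom
      simp flip: monom_0 one_pCons)

lemma qK_power_eq_iff [simp]: "qK ^ m = qK ^ l \<longleftrightarrow> m = l"
  by (simp add: qK_power eq_fract monom_eq_iff')

lemma qK_nonzero [simp]: "qK \<noteq> 0"
  by (simp add: qK_def Zero_fract_def eq_fract)

lemma qK_power_eq_1_iff [simp]: "qK ^ m = 1 \<longleftrightarrow> m = 0" "1 = qK ^ m \<longleftrightarrow> m = 0"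
  using qK_power_eq_iff[of m 0] by auto

text \<open>The left side is the coefficient of X ^ M in the Lagrange interpolant \<open>L\<close>,
  since every \<open>B t\<close> is monic of degree M. \<open>L\<close> and \<open>p\<close> agree
  in M + 1 points and both have degree at most M.\<close>

lemma sum_lagrange_weights:
  fixes p :: "'a :: field poly" and x :: "nat \<Rightarrow> 'a"
  assumes inj: "inj_on x {..M}" and deg: "degree p \<le> M"
  shows "(\<Sum>t\<le>M. poly p (x t) / (\<Prod>s\<in>{..M} - {t}. x t - x s)) = coeff p M"
proof -
  define B where "B t = (\<Prod>s\<in>{..M} - {t}. [:- x s, 1:])" for t
  define D where "D t = (\<Prod>s\<in>{..M} - {t}. x t - x s)" for t
  define L where "L = (\<Sum>t\<le>M. smult (poly p (x t) / D t) (B t))"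
  have D: "D t \<noteq> 0" if "t \<le> M" for t
    using inj that by (auto simp: D_def inj_on_def)
  have degB: "degree (B t) = M" if "t \<le> M" for t
    using that by (simp add: B_def degree_prod_eq_sum_degree)
  have topB: "coeff (B t) M = 1" if "t \<le> M" for t
    using degB[OF that] lead_coeff_prod[of "\<lambda>s. [:- x s, 1:]" "{..M} - {t}"]
    by (simp add: B_def)
  have polyB: "poly (B t) (x u) = (if u = t then D t else 0)" if "t \<le> M" "u \<le> M" for t u
    using that by (auto simp: B_def D_def poly_prod)
  have degL: "degree L \<le> M"
    unfolding L_def using degB by (intro degree_sum_le) (auto intro: order.trans[OF degree_smult_le])
  have polyL: "poly L (x u) = poly p (x u)" if "u \<le> M" for u
  proof -
    have "poly L (x u) = (\<Sum>t\<le>M. poly p (x t) / D t * (if u = t then D t else 0))"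
      unfolding L_def using polyB that by (simp add: poly_sum)
    also have "\<dots> = (\<Sum>t\<le>M. if u = t then poly p (x t) / D t * D t else 0)"
      by (intro sum.cong) auto
    also have "\<dots> = poly p (x u)"
      using that D by (simp add: sum.delta)
    finally show ?thesis .
  qed
  have "L = p"
  proof (rule ccontr)
    assume "L \<noteq> p"
    then have "L - p \<noteq> 0" by simp
    from card_poly_roots_bound[OF this] have "card {z. poly (L - p) z = 0} \<le> M"
      using degree_diff_le[OF degL deg] by simp
    moreover have "card (x ` {..M}) \<le> card {z. poly (L - p) z = 0}"
      using polyL poly_roots_finite[OF \<open>L - p \<noteq> 0\<close>] by (intro card_mono) auto
    ultimately show False
      using card_image[OF inj] by simp
  qed
  moreover have "coeff L M = (\<Sum>t\<le>M. poly p (x t) / D t)"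
    unfolding L_def using topB by (simp add: coeff_sum)
  ultimately show ?thesis
    by (simp add: D_def)
qed

subsection \<open>Laurent series supports and evaluation of Laurent polynomials\<close>

definition lsupp :: "lser \<Rightarrow> (nat \<Rightarrow> int) set" where
  "lsupp f = {e. f e \<noteq> 0}"

text \<open>A sum over an infinite set is 0 by convention, so this is evaluation only for Laurent
  polynomials, and only in x_0, ..., x_n.\<close>

definition leval :: "nat \<Rightarrow> (nat \<Rightarrow> K) \<Rightarrow> lser \<Rightarrow> K" where
  "leval n c f = (\<Sum>e\<in>lsupp f. f e * (\<Prod>i\<le>n. c i powi e i))"

text \<open>A nonzero sum has a nonzero summand, and an infinite sum counts as 0. No finiteness
  enters, so the inclusion also covers the infinite series that occur when a parameter is 0.\<close>

lemma lsupp_lmul_subset: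
  "lsupp (lmul f g) \<subseteq> (\<lambda>(d, d'). \<lambda>k. d k + d' k) ` (lsupp f \<times> lsupp g)"
proof
  fix e assume "e \<in> lsupp (lmul f g)"
  then have "(\<Sum>d \<in> {d. f d \<noteq> 0 \<and> g (\<lambda>k. e k - d k) \<noteq> 0}. f d * g (\<lambda>k. e k - d k)) \<noteq> 0"
    by (simp add: lsupp_def lmul_def)
  then obtain d where "f d \<noteq> 0" "g (\<lambda>k. e k - d k) \<noteq> 0"
    by (rule sum.not_neutral_contains_not_neutral) auto
  then show "e \<in> (\<lambda>(d, d'). \<lambda>k. d k + d' k) ` (lsupp f \<times> lsupp g)"
    by (intro image_eqI[of _ _ "(d, \<lambda>k. e k - d k)"]) (auto simp: lsupp_def)
qed

lemma lsupp_lmulE: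
  assumes "e \<in> lsupp (lmul f g)"
  obtains d d' where "d \<in> lsupp f" "d' \<in> lsupp g" "e = (\<lambda>k. d k + d' k)"
  using assms lsupp_lmul_subset[of f g] by fast

lemma finite_lsupp_lmul:
  "finite (lsupp f) \<Longrightarrow> finite (lsupp g) \<Longrightarrow> finite (lsupp (lmul f g))"
  by (rule finite_subset[OF lsupp_lmul_subset]) auto

lemma leval_superset:
  assumes "finite E" "lsupp f \<subseteq> E"
  shows "leval n c f = (\<Sum>e\<in>E. f e * (\<Prod>i\<le>n. c i powi e i))"
  unfolding leval_def using assms by (intro sum.mono_neutral_left) (auto simp: lsupp_def)

lemma leval_lmul:
  assumes fin: "finite (lsupp f)" "finite (lsupp g)" and c: "\<And>i. i \<le> n \<Longrightarrow> c i \<noteq> 0"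
  shows "leval n c (lmul f g) = leval n c f * leval n c g"
proof -
  define X where "X e = (\<Prod>i\<le>n. c i powi e i)" for e
  define h where "h = (\<lambda>(d :: nat \<Rightarrow> int, d' :: nat \<Rightarrow> int). \<lambda>k. d k + d' k)"
  define E where "E = h ` (lsupp f \<times> lsupp g)"
  have X: "X (h (d, d')) = X d * X d'" for d d'
    using c by (simp add: X_def h_def power_int_add prod.distrib)
  \<comment> \<open>The pairs with sum e correspond to the summation index d of the Cauchy
    product.\<close>
  have inner: "(\<Sum>z\<in>{z \<in> lsupp f \<times> lsupp g. h z = e}. f (fst z) * g (snd z)) = lmul f g e" for e
    unfolding lmul_def
  proof (intro sum.reindex_bij_witness[of _ "\<lambda>d. (d, \<lambda>k. e k - d k)" fst], goal_cases)
    case (1 z) then show ?case by (auto simp: h_def)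
  next
    case (2 z) then show ?case by (auto simp: h_def lsupp_def)
  next
    case (3 z) then show ?case by auto
  next
    case (4 z) then show ?case by (auto simp: h_def lsupp_def)
  next
    case (5 z) then show ?case by (auto simp: h_def lsupp_def)
  qed
  have "leval n c f * leval n c g
      = (\<Sum>z\<in>lsupp f \<times> lsupp g. (f (fst z) * X (fst z)) * (g (snd z) * X (snd z)))"
    by (simp add: leval_def X_def sum_product sum.cartesian_product case_prod_unfold)
  also have "\<dots> = (\<Sum>z\<in>lsupp f \<times> lsupp g. f (fst z) * g (snd z) * X (h z))"
    by (intro sum.cong) (auto simp: X mult_ac)
  also have "\<dots> = (\<Sum>e\<in>E. \<Sum>z\<in>{z \<in> lsupp f \<times> lsupp g. h z = e}. f (fst z) * g (snd z) * X (h z))"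
    unfolding E_def using fin by (intro sum.image_gen) auto
  also have "\<dots> = (\<Sum>e\<in>E. lmul f g e * X e)"
    by (intro sum.cong) (auto simp: sum_distrib_right simp flip: inner)
  also have "\<dots> = leval n c (lmul f g)"
    unfolding X_def using lsupp_lmul_subset[of f g] fin
    by (intro leval_superset[symmetric]) (auto simp: E_def h_def)
  finally show ?thesis ..
qed

lemma lsupp_lone: "lsupp lone = {\<lambda>_. 0}"
  by (auto simp: lsupp_def lone_def)

lemma leval_lone [simp]: "leval n c lone = 1"
  by (simp add: leval_def lsupp_lone) (simp add: lone_def)

lemma lsupp_lmono: "lsupp (lmono e) = {e}"
  by (auto simp: lsupp_def lmono_def)

lemma leval_lmono: "leval n c (lmono e) = (\<Prod>i\<le>n. c i powi e i)"
  by (simp add: leval_def lsupp_lmono) (simp add: lmono_def)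

lemma lsupp_oneminus: "lsupp (oneminus z a b) \<subseteq> {\<lambda>_. 0, ratio a b}"
  by (auto simp: lsupp_def oneminus_def split: if_splits)

lemma leval_oneminus:
  assumes "a \<le> n" "b \<le> n" "a \<noteq> b" "c b \<noteq> 0"
  shows "leval n c (oneminus z a b) = 1 - z * c a / c b"
proof -
  have ne: "(\<lambda>_. 0) \<noteq> ratio a b"
    using assms by (auto simp: ratio_def uvec_def fun_eq_iff)
  have "(\<Prod>i\<le>n. c i powi ratio a b i) =
    (\<Prod>i\<le>n. (if i = a then c a else 1) * (if i = b then inverse (c b) else 1))"
    using assms by (intro prod.cong) (auto simp: ratio_def uvec_def power_int_minus)
  also have "\<dots> = c a / c b"
    using assms by (simp add: prod.distrib prod.delta divide_inverse)
  finally show ?thesis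
    using ne by (subst leval_superset[OF _ lsupp_oneminus]) (auto simp: oneminus_def)
qed

lemma leval_lprod:
  assumes "\<And>f. f \<in> set fs \<Longrightarrow> finite (lsupp f)" and c: "\<And>i. i \<le> n \<Longrightarrow> c i \<noteq> 0"
  shows "finite (lsupp (lprod fs))" "leval n c (lprod fs) = prod_list (map (leval n c) fs)"
proof -
  have "finite (lsupp (lprod fs)) \<and> leval n c (lprod fs) = prod_list (map (leval n c) fs)"
    using assms(1)
    by (induction fs) (auto simp: lprod_def lsupp_lone leval_lmul c finite_lsupp_lmul)
  then show "finite (lsupp (lprod fs))" "leval n c (lprod fs) = prod_list (map (leval n c) fs)"
    by auto
qed

section \<open>Constant terms by interpolation\<close>

text \<open>Weighting the nodes of variable i by \<open>W i\<close> extracts the coefficient of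
  degree \<open>M i\<close> from x_i ^ k times x_i ^ (M i - w i) times \<open>\<psi> i\<close>.
  Exponent vectors of total degree 0 other than the zero vector are killed by one of their negative
  entries, so only the constant term is left.\<close>

lemma CT_interpolation:
  fixes x :: "nat \<Rightarrow> K" and \<psi> :: "nat \<Rightarrow> K poly" and M w :: "nat \<Rightarrow> nat"
  assumes fin: "finite (lsupp F)"
    and x0: "\<And>t. x t \<noteq> 0" and inj: "inj x"
    and psi: "\<And>i. i \<le> n \<Longrightarrow> lead_coeff (\<psi> i) = 1" "\<And>i. i \<le> n \<Longrightarrow> degree (\<psi> i) = w i"
    and supp0: "\<And>e. e \<in> lsupp F \<Longrightarrow> (\<Sum>i\<le>n. e i) = 0"
    and supp1: "\<And>e k. e \<in> lsupp F \<Longrightarrow> k > n \<Longrightarrow> e k = 0"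
    and supp2: "\<And>e i. e \<in> lsupp F \<Longrightarrow> i \<le> n \<Longrightarrow> e i \<ge> int (w i) - int (M i)"
  shows "CT F = (\<Sum>\<alpha>\<in>PiE {..n} (\<lambda>i. {..M i}).
     leval n (\<lambda>i. x (\<alpha> i)) F * (\<Prod>i\<le>n. poly (\<psi> i) (x (\<alpha> i)) * x (\<alpha> i) powi (int (M i) - int (w i))
        / (\<Prod>s\<in>{..M i} - {\<alpha> i}. x (\<alpha> i) - x s)))"
proof -
  define W where "W i t = poly (\<psi> i) (x t) * x t powi (int (M i) - int (w i))
        / (\<Prod>s\<in>{..M i} - {t}. x t - x s)" for i t
  \<comment> \<open>Restricted to k at most 0: for k > 0 the degree of \<open>p\<close> exceeds
    \<open>M i\<close> and the sum is no longer a coefficient.\<close>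
  have one: "(\<Sum>t\<le>M i. x t powi k * W i t) = (if k = 0 then 1 else 0)"
    if i: "i \<le> n" and k: "k \<le> 0" "k \<ge> int (w i) - int (M i)" for i k
  proof -
    define m where "m = nat (k + int (M i) - int (w i))"
    define p where "p = monom 1 m * \<psi> i"
    have "\<psi> i \<noteq> 0" using psi(1)[OF i] by auto
    then have degp: "degree p = m + w i"
      using psi[OF i] by (simp add: p_def degree_mult_eq degree_monom_eq)
    have lc: "coeff p (m + w i) = 1"
      using psi[OF i] degp by (metis p_def lead_coeff_mult lead_coeff_monom mult_1)
    have le: "degree p \<le> M i" using k degp by (simp add: m_def)
    have "(\<Sum>t\<le>M i. x t powi k * W i t)
        = (\<Sum>t\<le>M i. poly p (x t) / (\<Prod>s\<in>{..M i} - {t}. x t - x s))"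
    proof (intro sum.cong refl)
      fix t
      have "x t powi k * x t powi (int (M i) - int (w i)) = x t ^ m"
        using x0[of t] k power_int_add[of "x t" k "int (M i) - int (w i)"]
        by (simp add: m_def power_int_nonneg_exp add_diff_eq)
      then show "x t powi k * W i t = poly p (x t) / (\<Prod>s\<in>{..M i} - {t}. x t - x s)"
        by (simp add: W_def p_def poly_monom mult_ac)
    qed
    also have "\<dots> = coeff p (M i)"
      using le inj by (intro sum_lagrange_weights) (auto intro: inj_on_subset)
    also have "\<dots> = (if k = 0 then 1 else 0)"
    proof (cases "k = 0")
      case True
      then have "m + w i = M i" using k by (simp add: m_def)
      then show ?thesis using lc True by simp
    next
      case False
      then have "degree p < M i" using k degp by (simp add: m_def)
      then show ?thesis using False by (simp add: coeff_eq_0)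
    qed
    finally show ?thesis .
  qed
  \<comment> \<open>This makes the restriction to nonpositive exponents sufficient: one vanishing
    factor is enough, whatever the positive exponents contribute.\<close>
  have low: "\<exists>i\<le>n. e i < 0" if "e \<in> lsupp F" "e \<noteq> (\<lambda>_. 0)" for e
  proof (rule ccontr)
    assume "\<not> (\<exists>i\<le>n. e i < 0)"
    then have nn: "\<And>i. i \<le> n \<Longrightarrow> e i \<ge> 0" by (auto simp: not_less)
    have "\<forall>i\<in>{..n}. e i = 0"
      using supp0[OF that(1)] nn by (subst sum_nonneg_eq_0_iff[symmetric]) auto
    with supp1[OF that(1)] have "e = (\<lambda>_. 0)"
      by (metis atMost_iff ext not_le)
    with that show False by simp
  qed
  have mono: "(\<Prod>i\<le>n. \<Sum>t\<le>M i. x t powi e i * W i t) = (if e = (\<lambda>_. 0) then 1 else 0)"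
    if e: "e \<in> lsupp F" for e
  proof (cases "e = (\<lambda>_. 0)")
    case True
    have "(\<Sum>t\<le>M i. x t powi e i * W i t) = 1" if "i \<le> n" for i
      using one[of i 0] supp2[OF e that] that True by simp
    then show ?thesis using True by simp
  next
    case False
    then obtain i where "i \<le> n" "e i < 0" using low[OF e] by auto
    then have "(\<Sum>t\<le>M i. x t powi e i * W i t) = 0"
      using one supp2[OF e] by simp
    then show ?thesis using False \<open>i \<le> n\<close> by (auto intro!: prod_zero)
  qed
  have "CT F = (\<Sum>e\<in>lsupp F. if e = (\<lambda>_. 0) then F e else 0)"
    using fin by (simp add: CT_def sum.delta lsupp_def)
  also have "\<dots> = (\<Sum>e\<in>lsupp F. F e * (\<Prod>i\<le>n. \<Sum>t\<le>M i. x t powi e i * W i t))"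
    using mono by (intro sum.cong) auto
  also have "\<dots> = (\<Sum>e\<in>lsupp F. F e * (\<Sum>\<alpha>\<in>PiE {..n} (\<lambda>i. {..M i}). \<Prod>i\<le>n. x (\<alpha> i) powi e i * W i (\<alpha> i)))"
    by (subst prod_sum_PiE) auto
  also have "\<dots> = (\<Sum>\<alpha>\<in>PiE {..n} (\<lambda>i. {..M i}). leval n (\<lambda>i. x (\<alpha> i)) F * (\<Prod>i\<le>n. W i (\<alpha> i)))"
    by (simp add: leval_def sum_distrib_left sum_distrib_right sum.swap[of _ "lsupp F"]
        prod.distrib mult_ac)
  finally show ?thesis by (simp add: W_def)
qed

section \<open>Support bounds for D_n\<close>

text \<open>Additivity is what carries a lower bound through Cauchy products. Coordinates, the total
  degree and their negatives are the instances; a form together with its negative yields an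
  equation.\<close>

definition lin_form :: "((nat \<Rightarrow> int) \<Rightarrow> int) \<Rightarrow> bool" where
  "lin_form \<phi> \<longleftrightarrow> (\<forall>d d'. \<phi> (\<lambda>k. d k + d' k) = \<phi> d + \<phi> d')"

lemma lin_form_add: "lin_form \<phi> \<Longrightarrow> \<phi> (\<lambda>k. d k + d' k) = \<phi> d + \<phi> d'"
  by (simp add: lin_form_def)

lemma lin_form_zero: "lin_form \<phi> \<Longrightarrow> \<phi> (\<lambda>_. 0) = 0"
  using lin_form_add[of \<phi> "\<lambda>_. 0" "\<lambda>_. 0"] by simp

lemma lin_form_of_nat_mult:
  assumes "lin_form \<phi>" shows "\<phi> (\<lambda>k. int l * d k) = int l * \<phi> d"
proof (induction l)
  case 0 then show ?case using lin_form_zero[OF assms] by simp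
next
  case (Suc l)
  have "\<phi> (\<lambda>k. int (Suc l) * d k) = \<phi> (\<lambda>k. int l * d k + d k)"
    by (simp add: algebra_simps)
  then show ?case
    using lin_form_add[OF assms, of "\<lambda>k. int l * d k" d] Suc.IH by (simp add: algebra_simps)
qed

text \<open>Abstracts one level of the nested list in \<open>Dn\<close>; it is applied to the inner
  and then to the outer list, with \<open>R h w\<close> saying that w bounds the form from below on
  the support of h.\<close>

lemma foldr_lmul_concat:
  fixes u :: "nat \<Rightarrow> int"
  assumes "\<And>i h w. i < j \<Longrightarrow> R h w \<Longrightarrow> R (foldr lmul (L i) h) (u i + w)" and "R h w"
  shows "R (foldr lmul (concat (map L [0..<j])) h) ((\<Sum>i<j. u i) + w)"
  using assms
proof (induction j arbitrary: h w)
  case (Suc j)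
  have "R (foldr lmul (L j) h) (u j + w)" using Suc.prems by simp
  then have "R (foldr lmul (concat (map L [0..<j])) (foldr lmul (L j) h)) ((\<Sum>i<j. u i) + (u j + w))"
    using Suc.IH Suc.prems(1) by simp
  then show ?case by (simp add: add.assoc)
qed simp

lemma lsupp_lmul_bound:
  assumes "lin_form \<phi>" "\<forall>e\<in>lsupp f. u \<le> \<phi> e" "\<forall>e\<in>lsupp g. w \<le> \<phi> e"
  shows "\<forall>e\<in>lsupp (lmul f g). u + w \<le> \<phi> e"
proof
  fix e assume "e \<in> lsupp (lmul f g)"
  then show "u + w \<le> \<phi> e"
    using assms(2,3) lin_form_add[OF assms(1)]
    by (elim lsupp_lmulE) (fastforce intro: add_mono)
qed

lemma lsupp_qpoch_bound:
  assumes "lin_form \<phi>" "e \<in> lsupp (qpoch c a b (int k))"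
  shows "int k * min 0 (\<phi> (ratio a b)) \<le> \<phi> e"
proof -
  have "\<forall>e\<in>lsupp (lprod (map f ms)). int (length ms) * min 0 (\<phi> (ratio a b)) \<le> \<phi> e"
    if "\<And>m. lsupp (f m) \<subseteq> {\<lambda>_. 0, ratio a b}" for f and ms :: "nat list"
  proof (induction ms)
    case Nil
    then show ?case by (simp add: lprod_def lsupp_lone lin_form_zero[OF assms(1)])
  next
    case (Cons m ms)
    have "\<forall>e\<in>lsupp (f m). min 0 (\<phi> (ratio a b)) \<le> \<phi> e"
      using that[of m] lin_form_zero[OF assms(1)] by auto
    from lsupp_lmul_bound[OF assms(1) this Cons.IH] show ?case
      by (simp add: lprod_def algebra_simps)
  qed
  from this[of "\<lambda>m. oneminus (c * qK ^ m) a b" "[0..<k]"] show ?thesis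
    using assms(2) lsupp_oneminus by (simp add: qpoch_def)
qed

text \<open>For b < a the expansion of 1 / (1 - c x_a / x_b) starts at l = 1, not at l = 0. This
  strictness is what makes the constant term vanish when a parameter is 0.\<close>

lemma lsupp_qpoch_minus_one_bound:
  assumes "lin_form \<phi>" "e \<in> lsupp (qpoch c a b (- 1))" "b < a" "0 \<le> \<phi> (ratio b a)"
  shows "\<phi> (ratio b a) \<le> \<phi> e"
proof -
  have "qpoch c a b (- 1) = lmul (geominv (c * inverse qK) a b) lone"
    by (simp add: qpoch_def lprod_def)
  then obtain d where d: "d \<in> lsupp (geominv (c * inverse qK) a b)" "e = d"
    using assms(2) by (auto elim!: lsupp_lmulE simp: lsupp_lone)
  then have "(\<Sum>l \<in> {l::nat. 1 \<le> l \<and> e = (\<lambda>k. int l * ratio b a k)}. (inverse (c * inverse qK)) ^ l) \<noteq> 0"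
    using assms(3) by (simp add: lsupp_def geominv_def)
  then obtain l :: nat where l: "1 \<le> l" "e = (\<lambda>k. int l * ratio b a k)"
    by (rule sum.not_neutral_contains_not_neutral) auto
  then show ?thesis
    using lin_form_of_nat_mult[OF assms(1), of l "ratio b a"] assms(4)
      mult_right_mono[of 1 "int l" "\<phi> (ratio b a)"] by simp
qed

lemma lsupp_Dn_bound:
  assumes lin: "lin_form \<phi>"
    and u: "\<And>i j e. i < j \<Longrightarrow> j \<le> n \<Longrightarrow> e \<in> lsupp (qpoch 1 i j (int (a i))) \<Longrightarrow> u i j \<le> \<phi> e"
    and v: "\<And>i j e. i < j \<Longrightarrow> j \<le> n \<Longrightarrow> e \<in> lsupp (qpoch qK j i (int (a j) - 1)) \<Longrightarrow> v i j \<le> \<phi> e"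
    and e: "e \<in> lsupp (Dn n a)"
  shows "(\<Sum>j\<le>n. \<Sum>i<j. u i j + v i j) \<le> \<phi> e"
proof -
  define R where "R h w = (\<forall>e\<in>lsupp h. w \<le> \<phi> e)" for h w
  define L where "L j i = [qpoch 1 i j (int (a i)), qpoch qK j i (int (a j) - 1)]" for i j
  have pair: "R (foldr lmul (L j i) h) ((u i j + v i j) + w)" if "i < j" "j \<le> n" "R h w" for i j h w
  proof -
    have "R (lmul (qpoch qK j i (int (a j) - 1)) h) (v i j + w)"
      using v that unfolding R_def by (intro lsupp_lmul_bound lin) auto
    with u[OF that(1,2)] have "R (lmul (qpoch 1 i j (int (a i))) (lmul (qpoch qK j i (int (a j) - 1)) h))
        (u i j + (v i j + w))"
      unfolding R_def by (intro lsupp_lmul_bound[OF lin, of "qpoch 1 i j (int (a i))"]) auto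
    then show ?thesis by (simp add: L_def add.assoc)
  qed
  have row: "R (foldr lmul (concat (map (L j) [0..<j])) h) ((\<Sum>i<j. u i j + v i j) + w)"
    if "j \<le> n" "R h w" for j h w
    using that pair by (intro foldr_lmul_concat[where R = R and L = "L j"]) auto
  have "R lone 0" by (simp add: R_def lsupp_lone lin_form_zero[OF lin])
  then have "R (foldr lmul (concat (map (\<lambda>j. concat (map (L j) [0..<j])) [0..<n+1])) lone)
      ((\<Sum>j<n+1. \<Sum>i<j. u i j + v i j) + 0)"
    using row by (intro foldr_lmul_concat[where R = R and L = "\<lambda>j. concat (map (L j) [0..<j])"]) auto
  with e show ?thesis
    by (simp add: R_def Dn_def lprod_def L_def[abs_def] lessThan_Suc_atMost del: upt_Suc)
qed

lemma ratio_apply: "ratio i j k = (if k = i then 1 else 0) - (if k = j then 1 else 0)"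
  by (simp add: ratio_def uvec_def)

lemma lin_form_coord: "lin_form (\<lambda>e. e k)" "lin_form (\<lambda>e. - e k)"
  by (auto simp: lin_form_def)

lemma lin_form_sum: "lin_form (\<lambda>e. \<Sum>i\<le>n. e i)" "lin_form (\<lambda>e. - (\<Sum>i\<le>n. e i))"
  by (auto simp: lin_form_def sum.distrib)

text \<open>If \<open>a k = 0\<close>, each of the \<open>k\<close> factors \<open>1 / (1 - x k / x i)\<close> with \<open>i < k\<close> expands in negative powers of
  \<open>x k\<close>.\<close>

lemma lsupp_Dn_zero_param:
  assumes k: "1 \<le> k" "k \<le> n" and ak: "a k = 0" and pos: "\<And>j. k < j \<Longrightarrow> j \<le> n \<Longrightarrow> 1 \<le> a j"
    and e: "e \<in> lsupp (Dn n a)"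
  shows "e k \<le> - int k"
proof -
  have "(\<Sum>j\<le>n. \<Sum>i<j. 0 + (if j = k then 1 else 0)) \<le> - e k"
  proof (rule lsupp_Dn_bound[OF lin_form_coord(2)[of k] _ _ e], goal_cases)
    case (1 i j d)
    then show ?case
      using lsupp_qpoch_bound[OF lin_form_coord(2)[of k] 1(3)] ak
      by (cases "i = k") (auto simp: ratio_apply min_def split: if_splits)
  next
    case (2 i j d)
    show ?case
    proof (cases "a j = 0")
      case True
      \<comment> \<open>A vanishing \<open>a j\<close> with j > k would give a series in x_k / x_j
        with unbounded positive exponents of x_k; \<open>pos\<close> excludes it.\<close>
      then have "j \<le> k" using pos[of j] 2 by force
      then show ?thesis
        using lsupp_qpoch_minus_one_bound[OF lin_form_coord(2)[of k], of d qK j i] 2 True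
        by (auto simp: ratio_apply split: if_splits)
    next
      case False
      then have eq: "int (a j) - 1 = int (a j - 1)" "j \<noteq> k" using ak by auto
      have d: "d \<in> lsupp (qpoch qK j i (int (a j - 1)))" using 2(3) unfolding eq .
      then show ?thesis
        using lsupp_qpoch_bound[OF lin_form_coord(2)[of k] d] eq(2)
        by (auto simp: ratio_apply min_def split: if_splits)
    qed
  qed
  also have "(\<Sum>j\<le>n. \<Sum>i<j. 0 + (if j = k then 1 else 0 :: int)) = int k"
  proof -
    have "(\<Sum>j\<le>n. \<Sum>i<j. 0 + (if j = k then 1 else 0 :: int)) = (\<Sum>j\<le>n. if j = k then int j else 0)"
      by (intro sum.cong) auto
    then show ?thesis using k by (simp add: sum.delta)
  qed
  finally show ?thesis by simp
qed

lemma sum_atMost_split_at: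
  fixes f :: "nat \<Rightarrow> 'a :: comm_monoid_add"
  assumes "k \<le> n"
  shows "(\<Sum>i\<le>n. f i) = (\<Sum>i<k. f i) + f k + (\<Sum>j\<in>{k<..n}. f j)"
proof -
  have "{..n} = ({..<k} \<union> {k}) \<union> {k<..n}" using assms by auto
  moreover have "sum f (({..<k} \<union> {k}) \<union> {k<..n}) = sum f ({..<k} \<union> {k}) + sum f {k<..n}"
    by (rule sum.union_disjoint) auto
  ultimately show ?thesis by (simp add: add.commute)
qed

text \<open>The factor for i < k lowers the exponent of x_k by at most \<open>a i\<close>, the
  factor for j > k by at most a j - 1. The n - k units saved by the -1 are the room for the
  auxiliary polynomials.\<close>

lemma lsupp_Dn_lower:
  assumes pos: "\<And>j. 1 \<le> j \<Longrightarrow> j \<le> n \<Longrightarrow> 1 \<le> a j" and e: "e \<in> lsupp (Dn n a)" and k: "k \<le> n"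
  shows "int (n - k) - (\<Sum>i\<le>n. int (a i)) + int (a k) \<le> e k"
proof -
  have "(\<Sum>j\<le>n. \<Sum>i<j. (if j = k then - int (a i) else 0) + (if i = k then 1 - int (a j) else 0)) \<le> e k"
  proof (rule lsupp_Dn_bound[OF lin_form_coord(1)[of k] _ _ e], goal_cases)
    case (1 i j d)
    then show ?case
      using lsupp_qpoch_bound[OF lin_form_coord(1)[of k] 1(3)]
      by (auto simp: ratio_apply min_def split: if_splits)
  next
    case (2 i j d)
    then obtain b where b: "a j = Suc b" using pos[of j] by (cases "a j") force+
    then have d: "d \<in> lsupp (qpoch qK j i (int b))" using 2(3) by simp
    have "min 0 (ratio j i k) = (if i = k then - 1 else 0)"
      using 2(1) by (auto simp: ratio_apply)
    with lsupp_qpoch_bound[OF lin_form_coord(1)[of k] d] show ?case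
      using 2(1) b by (cases "i = k") simp_all
  qed
  also have "(\<Sum>j\<le>n. \<Sum>i<j. (if j = k then - int (a i) else 0) + (if i = k then 1 - int (a j) else 0))
      = (\<Sum>j\<le>n. if j = k then (\<Sum>i<j. - int (a i)) else 0) + (\<Sum>j\<le>n. if k < j then 1 - int (a j) else 0)"
    unfolding sum.distrib
    by (intro arg_cong2[of _ _ _ _ "(+)"] sum.cong refl) (auto simp: sum.delta)
  also have "(\<Sum>j\<le>n. if j = k then (\<Sum>i<j. - int (a i)) else 0) = - (\<Sum>i<k. int (a i))"
    using k by (simp add: sum.delta sum_negf)
  also have "(\<Sum>j\<le>n. if k < j then 1 - int (a j) else 0) = (\<Sum>j\<in>{k<..n}. 1 - int (a j))"
    by (simp add: sum.If_cases) (rule sum.cong, auto)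
  also have "\<dots> = int (n - k) - (\<Sum>j\<in>{k<..n}. int (a j))"
    by (simp add: sum_subtractf)
  also have "- (\<Sum>i<k. int (a i)) + (int (n - k) - (\<Sum>j\<in>{k<..n}. int (a j)))
    = int (n - k) - (\<Sum>i\<le>n. int (a i)) + int (a k)"
    using sum_atMost_split_at[OF k, of "\<lambda>i. int (a i)"] by simp
  finally show ?thesis .
qed

text \<open>For positive parameters every exponent of D_n is a sum of exponents of ratios x_i / x_j.
  Applied to a form and its negative this shows that the form vanishes on the support.\<close>

lemma lsupp_Dn_zero:
  assumes pos: "\<And>j. 1 \<le> j \<Longrightarrow> j \<le> n \<Longrightarrow> 1 \<le> a j" and e: "e \<in> lsupp (Dn n a)"
    and lin: "lin_form \<phi>" and \<phi>: "\<And>i j. i \<le> n \<Longrightarrow> j \<le> n \<Longrightarrow> \<phi> (ratio i j) = 0"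
  shows "0 \<le> \<phi> e"
proof -
  have "(\<Sum>j\<le>n. \<Sum>i<j. 0 + 0) \<le> \<phi> e"
  proof (rule lsupp_Dn_bound[OF lin _ _ e], goal_cases)
    case (1 i j d)
    then show ?case
      using lsupp_qpoch_bound[OF lin 1(3)] \<phi>[of i j] by simp
  next
    case (2 i j d)
    then have eq: "int (a j) - 1 = int (a j - 1)" using pos[of j] by force
    have d: "d \<in> lsupp (qpoch qK j i (int (a j - 1)))" using 2(3) unfolding eq .
    with lsupp_qpoch_bound[OF lin d] 2 \<phi>[of j i] show ?case by simp
  qed
  then show ?thesis by simp
qed

lemma lsupp_Dn_total:
  assumes pos: "\<And>j. 1 \<le> j \<Longrightarrow> j \<le> n \<Longrightarrow> 1 \<le> a j" and e: "e \<in> lsupp (Dn n a)"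
  shows "(\<Sum>i\<le>n. e i) = 0"
proof -
  have "(\<Sum>k\<le>n. ratio i j k) = 0" if "i \<le> n" "j \<le> n" for i j
    using that by (simp add: ratio_apply sum_subtractf sum.delta)
  then show ?thesis
    using lsupp_Dn_zero[OF pos e lin_form_sum(1)[of n]] lsupp_Dn_zero[OF pos e lin_form_sum(2)[of n]]
    by force
qed

lemma lsupp_Dn_outside:
  assumes pos: "\<And>j. 1 \<le> j \<Longrightarrow> j \<le> n \<Longrightarrow> 1 \<le> a j" and e: "e \<in> lsupp (Dn n a)" and k: "n < k"
  shows "e k = 0"
proof -
  have "ratio i j k = 0" if "i \<le> n" "j \<le> n" for i j
    using that k by (simp add: ratio_apply)
  then show ?thesis
    using lsupp_Dn_zero[OF pos e lin_form_coord(1)[of k]] lsupp_Dn_zero[OF pos e lin_form_coord(2)[of k]]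
    by force
qed

section \<open>Values of D_n at a point\<close>

lemma leval_qpoch:
  assumes c: "\<And>i. i \<le> n \<Longrightarrow> c i \<noteq> 0" and "i \<le> n" "j \<le> n" "i \<noteq> j"
  shows "finite (lsupp (qpoch z i j (int k)))"
    and "leval n c (qpoch z i j (int k)) = (\<Prod>m<k. 1 - z * qK ^ m * c i / c j)"
proof -
  have fin: "finite (lsupp (oneminus z' i j))" for z'
    by (rule finite_subset[OF lsupp_oneminus]) simp
  show "finite (lsupp (qpoch z i j (int k)))"
    unfolding qpoch_def using fin c
    by (simp, intro leval_lprod(1)[of _ n c]) auto
  have "leval n c (qpoch z i j (int k)) = prod_list (map (\<lambda>m. 1 - z * qK ^ m * c i / c j) [0..<k])"
    unfolding qpoch_def using assms fin c
    by (simp, subst leval_lprod) (auto simp: leval_oneminus comp_def)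
  also have "\<dots> = (\<Prod>m<k. 1 - z * qK ^ m * c i / c j)"
    by (simp add: prod.list_conv_set_nth lessThan_atLeast0)
  finally show "leval n c (qpoch z i j (int k)) = (\<Prod>m<k. 1 - z * qK ^ m * c i / c j)" .
qed

lemma prod_list_concat_upt:
  fixes g :: "'a \<Rightarrow> 'b :: comm_monoid_mult"
  shows "prod_list (map g (concat (map L [0..<j]))) = (\<Prod>i<j. prod_list (map g (L i)))"
  by (induction j) auto

lemma leval_Dn:
  assumes pos: "\<And>j. 1 \<le> j \<Longrightarrow> j \<le> n \<Longrightarrow> 1 \<le> a j" and c: "\<And>i. i \<le> n \<Longrightarrow> c i \<noteq> 0"
  shows "finite (lsupp (Dn n a))"
    and "leval n c (Dn n a) = (\<Prod>j\<le>n. \<Prod>i<j.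
      (\<Prod>m<a i. 1 - qK ^ m * c i / c j) * (\<Prod>m<a j - 1. 1 - qK ^ Suc m * c j / c i))"
proof -
  let ?fs = "concat (map (\<lambda>j. concat (map (\<lambda>i.
       [qpoch 1 i j (int (a i)), qpoch qK j i (int (a j) - 1)]) [0..<j])) [0..<n+1])"
  have eq: "int (a j) - 1 = int (a j - 1)" if "i < j" "j \<le> n" for i j
    using pos[of j] that by force
  have fin: "finite (lsupp f)" if f: "f \<in> set ?fs" for f
  proof -
    obtain i j where ij: "i < j" "j \<le> n"
      and cases: "f = qpoch 1 i j (int (a i)) \<or> f = qpoch qK j i (int (a j) - 1)"
      using f by auto
    have "finite (lsupp (qpoch 1 i j (int (a i))))" "finite (lsupp (qpoch qK j i (int (a j - 1))))"
      using leval_qpoch(1)[of n "\<lambda>_. 1"] ij by simp_all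
    then show ?thesis
      using cases unfolding eq[OF ij] by blast
  qed
  from leval_lprod(1)[of ?fs n c, OF fin c] show "finite (lsupp (Dn n a))"
    unfolding Dn_def by blast
  have "leval n c (Dn n a) = prod_list (map (leval n c) ?fs)"
    unfolding Dn_def by (intro leval_lprod fin c)
  also have "\<dots> = (\<Prod>j<n+1. \<Prod>i<j. leval n c (qpoch 1 i j (int (a i))) * leval n c (qpoch qK j i (int (a j) - 1)))"
    unfolding prod_list_concat_upt by simp
  also have "\<dots> = (\<Prod>j\<le>n. \<Prod>i<j.
      (\<Prod>m<a i. 1 - qK ^ m * c i / c j) * (\<Prod>m<a j - 1. 1 - qK ^ Suc m * c j / c i))"
    using c by (intro prod.cong arg_cong2[of _ _ _ _ "(*)"])
      (auto simp: eq leval_qpoch less_Suc_eq_le)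
  finally show "leval n c (Dn n a) = (\<Prod>j\<le>n. \<Prod>i<j.
      (\<Prod>m<a i. 1 - qK ^ m * c i / c j) * (\<Prod>m<a j - 1. 1 - qK ^ Suc m * c j / c i))" .
qed

text \<open>The two factors of D_n for the pair i < j, multiplied by c_j ^ a_i and c_i ^ (a_j - 1)
  so that only linear forms remain.\<close>

definition pair_factor :: "(nat \<Rightarrow> nat) \<Rightarrow> (nat \<Rightarrow> K) \<Rightarrow> nat \<Rightarrow> nat \<Rightarrow> K" where
  "pair_factor a c i j = (\<Prod>m<a i. c j - qK ^ m * c i) * (\<Prod>m<a j - 1. c i - qK ^ Suc m * c j)"

lemma power_int_sum:
  fixes x :: "'a :: field"
  assumes "x \<noteq> 0"
  shows "x powi (\<Sum>i\<in>A. f i) = (\<Prod>i\<in>A. x powi f i)"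
  using assms by (induction A rule: infinite_finite_induct) (auto simp: power_int_add)

text \<open>The power of each variable that is split off is its smallest possible exponent according
  to \<open>lsupp_Dn_lower\<close>.\<close>

lemma leval_Dn_pair_factor:
  assumes pos: "\<And>j. 1 \<le> j \<Longrightarrow> j \<le> n \<Longrightarrow> 1 \<le> a j" and c: "\<And>i. i \<le> n \<Longrightarrow> c i \<noteq> 0"
  shows "leval n c (Dn n a) = (\<Prod>j\<le>n. \<Prod>i<j. pair_factor a c i j)
     * (\<Prod>k\<le>n. c k powi (int (n - k) - (\<Sum>i\<le>n. int (a i)) + int (a k)))"
proof -
  have pair: "(\<Prod>m<a i. 1 - qK ^ m * c i / c j) * (\<Prod>m<a j - 1. 1 - qK ^ Suc m * c j / c i)
     = pair_factor a c i j * (c j powi (- int (a i)) * c i powi (1 - int (a j)))"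
    if ij: "i < j" "j \<le> n" for i j
  proof -
    have [simp]: "c i \<noteq> 0" "c j \<noteq> 0" using c ij by auto
    have "(\<Prod>m<a i. 1 - qK ^ m * c i / c j) = (\<Prod>m<a i. (c j - qK ^ m * c i) / c j)"
      by (intro prod.cong) (auto simp: field_simps)
    also have "\<dots> = (\<Prod>m<a i. c j - qK ^ m * c i) * c j powi (- int (a i))"
      by (simp only: prod_dividef) (simp add: power_int_minus divide_inverse)
    finally have 1: "(\<Prod>m<a i. 1 - qK ^ m * c i / c j)
        = (\<Prod>m<a i. c j - qK ^ m * c i) * c j powi (- int (a i))" .
    have "(\<Prod>m<a j - 1. 1 - qK ^ Suc m * c j / c i) = (\<Prod>m<a j - 1. (c i - qK ^ Suc m * c j) / c i)"
      by (intro prod.cong) (auto simp: field_simps)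
    also have "\<dots> = (\<Prod>m<a j - 1. c i - qK ^ Suc m * c j) * c i powi (- int (a j - 1))"
      by (simp only: prod_dividef) (simp add: power_int_minus divide_inverse)
    also have "- int (a j - 1) = 1 - int (a j)"
      using pos[of j] ij by force
    finally have 2: "(\<Prod>m<a j - 1. 1 - qK ^ Suc m * c j / c i)
       = (\<Prod>m<a j - 1. c i - qK ^ Suc m * c j) * c i powi (1 - int (a j))" .
    show ?thesis unfolding 1 2 pair_factor_def by (simp add: mult_ac)
  qed
  have "leval n c (Dn n a) = (\<Prod>j\<le>n. \<Prod>i<j.
      pair_factor a c i j * (c j powi (- int (a i)) * c i powi (1 - int (a j))))"
    by (subst leval_Dn(2)[of n a c, OF pos c]) (auto intro!: prod.cong pair simp del: power_Suc One_nat_def)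
  also have "\<dots> = (\<Prod>j\<le>n. \<Prod>i<j. pair_factor a c i j) *
      ((\<Prod>j\<le>n. \<Prod>i<j. c j powi (- int (a i))) * (\<Prod>j\<le>n. \<Prod>i<j. c i powi (1 - int (a j))))"
    by (simp add: prod.distrib)
  also have "(\<Prod>j\<le>n. \<Prod>i<j. c i powi (1 - int (a j))) = (\<Prod>i\<le>n. \<Prod>j=Suc i..n. c i powi (1 - int (a j)))"
    unfolding prod.nested_swap' by (simp flip: lessThan_Suc_atMost)
  also have "(\<Prod>j\<le>n. \<Prod>i<j. c j powi (- int (a i))) * \<dots>
      = (\<Prod>k\<le>n. c k powi (int (n - k) - (\<Sum>i\<le>n. int (a i)) + int (a k)))"
    unfolding prod.distrib[symmetric]
  proof (intro prod.cong refl)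
    fix k assume "k \<in> {..n}"
    then have k: "k \<le> n" and ck: "c k \<noteq> 0" using c by auto
    have "(\<Sum>i\<le>n. int (a i)) = (\<Sum>i<k. int (a i)) + int (a k) + (\<Sum>j=Suc k..n. int (a j))"
      using sum_atMost_split_at[OF k, of "\<lambda>i. int (a i)"] by (simp add: atLeastSucAtMost_greaterThanAtMost)
    then have "int (n - k) - (\<Sum>i\<le>n. int (a i)) + int (a k)
       = (\<Sum>i<k. - int (a i)) + (\<Sum>j=Suc k..n. 1 - int (a j))"
      using k by (simp add: sum_subtractf sum_negf of_nat_diff)
    then show "(\<Prod>i<k. c k powi - int (a i)) * (\<Prod>j=Suc k..n. c k powi (1 - int (a j)))
      = c k powi (int (n - k) - (\<Sum>i\<le>n. int (a i)) + int (a k))"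
      using ck by (simp only: power_int_add[OF disjI1[OF ck]] power_int_sum[OF ck])
  qed
  finally show ?thesis .
qed

subsection \<open>Tight chains\<close>

text \<open>The intervals of lengths \<open>a (\<pi> 0)\<close>, \<open>a (\<pi> 1)\<close>, ... are
  laid end to end from 0, and the value at i is the left end of its interval. Restriction makes the
  function an element of the grid \<open>PiE\<close>.\<close>

definition chain :: "nat \<Rightarrow> (nat \<Rightarrow> nat) \<Rightarrow> (nat \<Rightarrow> nat) \<Rightarrow> nat \<Rightarrow> nat" where
  "chain n a \<pi> = restrict (\<lambda>i. \<Sum>l<inv_into {..n} \<pi> i. a (\<pi> l)) {..n}"

lemma chain_apply:
  assumes "bij_betw \<pi> {..n} {..n}" "k \<le> n"
  shows "chain n a \<pi> (\<pi> k) = (\<Sum>l<k. a (\<pi> l))"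
  using assms by (auto simp: chain_def bij_betw_def inv_into_f_f)

lemma sum_perm_atMost:
  assumes "bij_betw \<pi> {..n::nat} {..n}"
  shows "(\<Sum>l\<le>n. f (\<pi> l)) = (\<Sum>i\<le>n. f i)"
  by (rule sum.reindex_bij_betw[OF assms])

lemma sum_lessThan_plus_le:
  fixes c :: "nat \<Rightarrow> nat"
  assumes "k < l"
  shows "(\<Sum>i<k. c i) + c k \<le> (\<Sum>i<l. c i)"
proof -
  have "(\<Sum>i<Suc k. c i) \<le> (\<Sum>i<l. c i)"
    using assms by (intro sum_mono2) auto
  then show ?thesis by simp
qed

lemma chain_in_PiE:
  assumes "bij_betw \<pi> {..n} {..n}"
  shows "chain n a \<pi> \<in> PiE {..n} (\<lambda>i. {..(\<Sum>i\<le>n. a i) - a i})"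
proof (rule PiE_I)
  fix i assume "i \<in> {..n}"
  then obtain k where k: "k \<le> n" "i = \<pi> k"
    using assms by (metis atMost_iff bij_betw_iff_bijections)
  have "(\<Sum>l<k. a (\<pi> l)) + a (\<pi> k) \<le> (\<Sum>l<Suc n. a (\<pi> l))"
    using k by (intro sum_lessThan_plus_le) simp
  then show "chain n a \<pi> i \<in> {..(\<Sum>i\<le>n. a i) - a i}"
    using k unfolding lessThan_Suc_atMost sum_perm_atMost[OF assms] by (simp add: chain_apply[OF assms])
qed (simp add: chain_def)

lemma pair_factor_nonzeroD:
  assumes "pair_factor a (\<lambda>i. qK ^ \<alpha> i) i j \<noteq> 0"
  shows "m < a i \<Longrightarrow> \<alpha> j \<noteq> m + \<alpha> i" "m < a j - 1 \<Longrightarrow> \<alpha> i \<noteq> Suc m + \<alpha> j"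
  using assms by (auto simp: pair_factor_def simp flip: power_add power_Suc)

text \<open>At a node where no pair factor vanishes the intervals \<open>[\<alpha> i, \<alpha> i + a i)\<close> are disjoint; they have total
  length \<open>\<Sum>i\<le>n. a i\<close> and lie in an interval of this length, so they are adjacent.
  A possibly empty interval of index \<open>0\<close> precedes a nonempty one with the same left end.\<close>

lemma nonvanishing_node_is_chain:
  assumes pos: "\<And>j. 1 \<le> j \<Longrightarrow> j \<le> n \<Longrightarrow> 1 \<le> a j"
    and \<alpha>: "\<alpha> \<in> PiE {..n} (\<lambda>i. {..(\<Sum>i\<le>n. a i) - a i})"
    and nz: "(\<Prod>j\<le>n. \<Prod>i<j. pair_factor a (\<lambda>i. qK ^ \<alpha> i) i j) \<noteq> 0"
  obtains \<pi> where "bij_betw \<pi> {..n} {..n}" "\<alpha> = chain n a \<pi>"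
proof -
  define key where "key i = 2 * \<alpha> i + (if i = 0 then 0 else 1)" for i
  have pair: "pair_factor a (\<lambda>i. qK ^ \<alpha> i) i j \<noteq> 0" if "i < j" "j \<le> n" for i j
    using nz that by auto
  have gap: "\<alpha> i + a i \<le> \<alpha> j" if ij: "i \<le> n" "j \<le> n" "i \<noteq> j" and le: "key i \<le> key j" for i j
  proof (rule ccontr)
    assume "\<not> \<alpha> i + a i \<le> \<alpha> j"
    then have less: "\<alpha> j < \<alpha> i + a i" by simp
    have le': "\<alpha> i \<le> \<alpha> j" using le by (auto simp: key_def split: if_splits)
    consider "i < j" | "j < i" "\<alpha> i < \<alpha> j" | "j < i" "\<alpha> i = \<alpha> j" using ij le' by linarith
    then show False
    proof cases
      case 1
      moreover have "\<alpha> j - \<alpha> i < a i" using less le' by linarith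
      ultimately show False
        using pair_factor_nonzeroD(1)[OF pair[of i j], of "\<alpha> j - \<alpha> i"] le' ij by auto
    next
      case 2
      moreover have "\<alpha> j - \<alpha> i - 1 < a i - 1" using less 2 by linarith
      ultimately show False
        using pair_factor_nonzeroD(2)[OF pair[of j i], of "\<alpha> j - \<alpha> i - 1"] ij by auto
    next
      \<comment> \<open>Equal left ends: the order of the keys excludes j = 0, so the interval of j
        is nonempty and the linear form with m = 0 vanishes.\<close>
      case 3
      then have "j \<noteq> 0" using le by (cases "j = 0") (auto simp: key_def)
      then have "1 \<le> a j" using pos ij by simp
      then show False
        using pair_factor_nonzeroD(1)[OF pair[of j i], of 0] 3 ij by auto
    qed
  qed
  define xs where "xs = sort_key key [0..<Suc n]"
  define \<pi> where "\<pi> k = xs ! k" for k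
  have len: "length xs = Suc n" by (simp add: xs_def)
  have "set xs = {..n}"
    by (simp add: xs_def lessThan_Suc_atMost atLeast0LessThan del: upt_Suc)
  moreover have "distinct xs" by (simp add: xs_def del: upt_Suc)
  ultimately have bij: "bij_betw \<pi> {..n} {..n}"
    unfolding \<pi>_def[abs_def] by (intro bij_betw_nth) (simp_all only: len lessThan_Suc_atMost)
  have next_ge: "\<alpha> (\<pi> k) + a (\<pi> k) \<le> \<alpha> (\<pi> (Suc k))" if "k < n" for k
  proof (rule gap)
    show "\<pi> k \<le> n" "\<pi> (Suc k) \<le> n"
      using bij that by (auto simp: bij_betw_def)
    show "\<pi> k \<noteq> \<pi> (Suc k)"
      using inj_on_eq_iff[OF bij_betw_imp_inj_on[OF bij], of k "Suc k"] that by simp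
    have "sorted (map key xs)" by (simp add: xs_def del: upt_Suc)
    from sorted_nth_mono[OF this, of k "Suc k"] show "key (\<pi> k) \<le> key (\<pi> (Suc k))"
      using that len by (simp add: \<pi>_def)
  qed
  \<comment> \<open>Adding up the gaps from the left bounds every left end from below, adding them
    up from the right bounds it from above; the lengths sum to the length of the whole range, so the
    bounds meet.\<close>
  have low: "(\<Sum>l<k. a (\<pi> l)) \<le> \<alpha> (\<pi> k)" if "k \<le> n" for k
    using that
  proof (induction k)
    case (Suc k)
    then show ?case using next_ge[of k] by simp
  qed simp
  have high: "\<alpha> (\<pi> k) + (\<Sum>l=k..n. a (\<pi> l)) \<le> (\<Sum>i\<le>n. a i)" if "k \<le> n" for k
    using that
  proof (induction rule: inc_induct)
    case base
    have "\<pi> n \<le> n" using bij by (auto simp: bij_betw_def)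
    then have "\<alpha> (\<pi> n) \<le> (\<Sum>i\<le>n. a i) - a (\<pi> n)" "a (\<pi> n) \<le> (\<Sum>i\<le>n. a i)"
      using \<alpha> by (auto simp: PiE_def Pi_def intro: member_le_sum)
    then show ?case by simp
  next
    case (step k)
    then show ?case using next_ge[of k] by (simp add: sum.atLeast_Suc_atMost[of k])
  qed
  have eq: "\<alpha> (\<pi> k) = chain n a \<pi> (\<pi> k)" if k: "k \<le> n" for k
  proof -
    have "{..n} = {..<k} \<union> {k..n}" using k by auto
    moreover have "(\<Sum>l\<in>{..<k} \<union> {k..n}. a (\<pi> l)) = (\<Sum>l<k. a (\<pi> l)) + (\<Sum>l=k..n. a (\<pi> l))"
      by (rule sum.union_disjoint) auto
    ultimately have "(\<Sum>i\<le>n. a i) = (\<Sum>l<k. a (\<pi> l)) + (\<Sum>l=k..n. a (\<pi> l))"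
      using sum_perm_atMost[OF bij, of a] by simp
    then show ?thesis
      using low[OF k] high[OF k] by (simp add: chain_apply[OF bij k])
  qed
  have "\<alpha> = chain n a \<pi>"
  proof (rule PiE_ext[OF \<alpha> chain_in_PiE[OF bij]])
    fix i assume "i \<in> {..n}"
    then obtain k where "k \<le> n" "i = \<pi> k"
      using bij by (metis atMost_iff bij_betw_iff_bijections)
    then show "\<alpha> i = chain n a \<pi> i" using eq by simp
  qed
  with bij show ?thesis by (rule that)
qed

text \<open>Choosing the roots of the auxiliary polynomials \<open>\<psi>\<close> along a sequence \<open>s\<close> forces the chain to end with
  \<open>\<dots>, s 1, s 0\<close>.\<close>

lemma chain_tail_forced:
  assumes bij: "bij_betw \<pi> {..n} {..n}"
    and root: "\<And>i t. i \<le> n \<Longrightarrow> t < r i \<Longrightarrow>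
      poly (\<psi> i) (qK ^ ((\<Sum>i\<le>n. a i) - a i - (\<Sum>u<t. a (s u)))) = 0"
    and nz: "\<And>k. k \<le> n \<Longrightarrow> poly (\<psi> (\<pi> k)) (qK ^ chain n a \<pi> (\<pi> k)) \<noteq> 0"
    and rs: "\<And>u. u < m \<Longrightarrow> r (s u) = u"
    and ro: "\<And>i. i \<le> n \<Longrightarrow> i \<notin> s ` {..<m} \<Longrightarrow> m \<le> r i"
    and m: "m \<le> n"
  shows "t < m \<Longrightarrow> \<pi> (n - t) = s t" "r (\<pi> (n - m)) \<le> m"
proof -
  \<comment> \<open>Once the last t places are known, the left end at place n - t is the total minus
    its own length and the lengths to its right, which is root number t of its polynomial.\<close>
  have le: "r (\<pi> (n - t)) \<le> t" if t: "t \<le> n" and tail: "\<And>u. u < t \<Longrightarrow> \<pi> (n - u) = s u" for t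
  proof (rule ccontr)
    assume "\<not> r (\<pi> (n - t)) \<le> t"
    then have "t < r (\<pi> (n - t))" by simp
    moreover have "\<pi> (n - t) \<le> n" using bij by (auto simp: bij_betw_def)
    ultimately have "poly (\<psi> (\<pi> (n - t))) (qK ^ ((\<Sum>i\<le>n. a i) - a (\<pi> (n - t)) - (\<Sum>u<t. a (s u)))) = 0"
      by (intro root)
    moreover have "(\<Sum>i\<le>n. a i) - a (\<pi> (n - t)) - (\<Sum>u<t. a (s u)) = (\<Sum>l<n - t. a (\<pi> l))"
    proof -
      have "(\<Sum>u<t. a (s u)) = (\<Sum>u<t. a (\<pi> (n - u)))" by (simp add: tail)
      also have "\<dots> = (\<Sum>l\<in>{n - t<..n}. a (\<pi> l))"
        using t by (intro sum.reindex_bij_witness[of _ "\<lambda>l. n - l" "\<lambda>u. n - u"]) auto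
      finally show ?thesis
        using sum_atMost_split_at[of "n - t" n "\<lambda>l. a (\<pi> l)"] sum_perm_atMost[OF bij, of a] by simp
    qed
    ultimately show False
      using nz[of "n - t"] by (simp add: chain_apply[OF bij])
  qed
  have tail: "t < m \<Longrightarrow> \<pi> (n - t) = s t" for t
  proof (induction t rule: less_induct)
    case (less t)
    \<comment> \<open>Fewer than m roots identify an entry \<open>s u\<close> with u at most t, and
      the entries with u < t already sit further right.\<close>
    then have "r (\<pi> (n - t)) \<le> t" using m by (intro le) auto
    moreover have "\<pi> (n - t) \<le> n" using bij by (auto simp: bij_betw_def)
    ultimately obtain u where u: "u < m" "\<pi> (n - t) = s u"
      using ro[of "\<pi> (n - t)"] less.prems by auto
    with rs \<open>r (\<pi> (n - t)) \<le> t\<close> have "u \<le> t" by simp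
    moreover have False if "u < t"
    proof -
      have "\<pi> (n - t) = \<pi> (n - u)" using less.IH[OF that] u by simp
      then have "n - t = n - u" using bij by (auto simp: bij_betw_def inj_on_def)
      then show False using that less.prems m by simp
    qed
    ultimately show ?case using u by fastforce
  qed
  then show "t < m \<Longrightarrow> \<pi> (n - t) = s t" "r (\<pi> (n - m)) \<le> m"
    using le[OF m] by auto
qed

section \<open>The contribution of one order\<close>

lemma qfac_nonzero [simp]: "qfac m \<noteq> 0"
  by (simp add: qfac_def del: power_Suc)

lemma qfac_add: "qfac (c + r) = qfac c * (\<Prod>m<r. 1 - qK ^ (c + Suc m))"
  by (induction r) (simp_all add: qfac_def mult.assoc del: power_Suc)

text \<open>Passes from pairs of labels to pairs of places. The case distinction remains because
  \<open>g\<close> is not symmetric and expects its arguments in the order of the labels.\<close>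

lemma prod_pairs_perm:
  fixes g :: "nat \<Rightarrow> nat \<Rightarrow> 'a :: comm_monoid_mult"
  assumes bij: "bij_betw \<pi> {..n} {..n}"
  shows "(\<Prod>j\<le>n. \<Prod>i<j. g i j)
    = (\<Prod>l\<le>n. \<Prod>k<l. if \<pi> k < \<pi> l then g (\<pi> k) (\<pi> l) else g (\<pi> l) (\<pi> k))"
proof -
  define p where "p = inv_into {..n} \<pi>"
  have p: "p i \<le> n" "\<pi> (p i) = i" if "i \<le> n" for i
    using bij that inv_into_into[of i \<pi> "{..n}"] f_inv_into_f[of i \<pi> "{..n}"]
    by (auto simp: p_def bij_betw_def)
  have q: "p (\<pi> k) = k" "\<pi> k \<le> n" if "k \<le> n" for k
    using bij that by (auto simp: p_def bij_betw_def inv_into_f_f)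
  have "(\<Prod>z\<in>Sigma {..n} (\<lambda>j. {..<j}). g (snd z) (fst z))
    = (\<Prod>z\<in>Sigma {..n} (\<lambda>l. {..<l}). if \<pi> (snd z) < \<pi> (fst z)
        then g (\<pi> (snd z)) (\<pi> (fst z)) else g (\<pi> (fst z)) (\<pi> (snd z)))"
  proof (intro prod.reindex_bij_witness[of _
      "\<lambda>(l, k). (max (\<pi> l) (\<pi> k), min (\<pi> l) (\<pi> k))" "\<lambda>(j, i). (max (p j) (p i), min (p j) (p i))"],
      goal_cases)
    case (1 z)
    obtain j i where z: "z = (j, i)" "i < j" "j \<le> n" using 1 by auto
    then show ?case using p(2)[of i] p(2)[of j] by (cases "p i \<le> p j") (simp_all add: max_def min_def)
  next
    case (2 z)
    obtain j i where z: "z = (j, i)" "i < j" "j \<le> n" using 2 by auto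
    then have "p j \<noteq> p i" using p(2)[of i] p(2)[of j] by fastforce
    then show ?case using p(1)[of i] p(1)[of j] z by (cases "p i \<le> p j") (simp_all add: max_def min_def)
  next
    case (3 z)
    obtain l k where z: "z = (l, k)" "k < l" "l \<le> n" using 3 by auto
    then show ?case using q(1)[of l] q(1)[of k] by (cases "\<pi> k \<le> \<pi> l") (simp_all add: max_def min_def)
  next
    case (4 z)
    obtain l k where z: "z = (l, k)" "k < l" "l \<le> n" using 4 by auto
    then have "\<pi> l \<noteq> \<pi> k" using q(1)[of l] q(1)[of k] by fastforce
    then show ?case using q(2)[of l] q(2)[of k] z
      by (cases "\<pi> k \<le> \<pi> l") (simp_all add: max_def min_def)
  next
    case (5 z)
    obtain j i where z: "z = (j, i)" "i < j" "j \<le> n" using 5 by auto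
    then show ?case using p(2)[of i] p(2)[of j] by (cases "p i \<le> p j") (simp_all add: max_def min_def)
  qed
  then show ?thesis
    by (simp add: prod.Sigma case_prod_unfold)
qed

text \<open>Adjacent blocks fill an interval; this is how the tightness of a chain turns products
  over indices into uninterrupted runs of powers of q.\<close>

lemma prod_blocks:
  fixes F :: "nat \<Rightarrow> 'a :: comm_monoid_mult" and k l :: nat
  assumes "k \<le> l"
  shows "(\<Prod>i=k..<l. \<Prod>m<c i. F ((\<Sum>j<i. c j) + m)) = (\<Prod>t=(\<Sum>j<k. c j)..<(\<Sum>j<l. c j). F t)"
  using assms
proof (induction l rule: dec_induct)
  case (step l)
  have "(\<Sum>j<k. c j) \<le> (\<Sum>j<l. c j)" using step by (intro sum_mono2) auto
  then have "(\<Prod>t=(\<Sum>j<k. c j)..<(\<Sum>j<Suc l. c j). F t)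
      = (\<Prod>t=(\<Sum>j<k. c j)..<(\<Sum>j<l. c j). F t) * (\<Prod>t=(\<Sum>j<l. c j)..<(\<Sum>j<l. c j) + c l. F t)"
    by (simp add: prod.atLeastLessThan_concat)
  also have "(\<Prod>t=(\<Sum>j<l. c j)..<(\<Sum>j<l. c j) + c l. F t) = (\<Prod>m<c l. F ((\<Sum>j<l. c j) + m))"
    by (intro prod.reindex_bij_witness[of _ "\<lambda>m. (\<Sum>j<l. c j) + m" "\<lambda>t. t - (\<Sum>j<l. c j)"]) auto
  finally show ?case using step by simp
qed simp

text \<open>Makes the asymmetric pair factor uniform in the order of the labels. Both cases are
  completed to full runs \<open>z 0\<close>, ..., \<open>z (c k - 1)\<close> and \<open>y 1\<close>,
  ..., \<open>y (c l)\<close>, at the cost of dividing by \<open>y (c l)\<close>; if the labels are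
  inverted, \<open>y 0\<close> is traded for \<open>z 0 = - y 0\<close>, which gives the
  sign.\<close>

lemma pair_factor_chain:
  fixes c :: "nat \<Rightarrow> nat"
  assumes "k < l" and lab: "i \<noteq> j" "a i = c k" "a j = c l" and pos: "0 < i \<Longrightarrow> 1 \<le> a i" "0 < j \<Longrightarrow> 1 \<le> a j"
    and x: "x i = qK ^ (\<Sum>t<k. c t)" "x j = qK ^ (\<Sum>t<l. c t)"
  shows "(if i < j then pair_factor a x i j else pair_factor a x j i)
    = (if i < j then 1 else - 1) * (\<Prod>m<c k. qK ^ (\<Sum>t<l. c t) - qK ^ ((\<Sum>t<k. c t) + m))
      * (\<Prod>m<c l. qK ^ (\<Sum>t<k. c t) - qK ^ Suc ((\<Sum>t<l. c t) + m))
      / (qK ^ (\<Sum>t<k. c t) - qK ^ (\<Sum>t<Suc l. c t))"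
proof -
  define P where "P k = (\<Sum>t<k. c t)" for k
  define y where "y m = qK ^ P k - qK ^ (P l + m)" for m
  define z where "z m = qK ^ P l - qK ^ (P k + m)" for m
  have le: "P k + c k \<le> P l" using sum_lessThan_plus_le[OF \<open>k < l\<close>] by (simp add: P_def)
  have "0 < c k + c l" using lab pos by (cases "i = 0") auto
  then have yc: "y (c l) \<noteq> 0" using le by (auto simp: y_def)
  show ?thesis
  proof (cases "i < j")
    case True
    then obtain b where b: "c l = Suc b" using pos lab by (cases "c l") auto
    have "pair_factor a x i j = (\<Prod>m<c k. z m) * (\<Prod>m<b. y (Suc m))"
      unfolding pair_factor_def using lab b x
      by (simp add: y_def z_def P_def power_add mult_ac)
    also have "\<dots> = (\<Prod>m<c k. z m) * (\<Prod>m<c l. y (Suc m)) / y (c l)"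
      using yc b by simp
    finally show ?thesis using True by (simp add: y_def z_def P_def)
  next
    case False
    then have "j < i" using lab by simp
    then obtain b where b: "c k = Suc b" using pos lab by (cases "c k") auto
    have z0: "z 0 = - y 0" "y 0 \<noteq> 0" using le b by (auto simp: y_def z_def)
    have "y 0 * (\<Prod>m<c l. y (Suc m)) = (\<Prod>m<c l. y m) * y (c l)"
      using prod.lessThan_Suc_shift[of y "c l"] prod.lessThan_Suc[of y "c l"] by simp
    then have 1: "(\<Prod>m<c l. y m) = y 0 * (\<Prod>m<c l. y (Suc m)) / y (c l)"
      using yc by (simp add: field_simps)
    have 2: "(\<Prod>m<c k. z m) = z 0 * (\<Prod>m<b. z (Suc m))"
      unfolding b by (rule prod.lessThan_Suc_shift)
    have "pair_factor a x j i = (\<Prod>m<c l. y m) * (\<Prod>m<b. z (Suc m))"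
      unfolding pair_factor_def using lab b x
      by (simp add: y_def z_def P_def power_add mult_ac)
    also have "\<dots> = - 1 * (\<Prod>m<c k. z m) * (\<Prod>m<c l. y (Suc m)) / y (c l)"
      unfolding 1 2 z0 by simp
    finally show ?thesis using False by (simp add: y_def z_def P_def)
  qed
qed

text \<open>For an interval with left end p, length c and r units to its right: the nodes below p
  cancel, the powers of q cancel, and a q-binomial coefficient is left.\<close>

lemma lagrange_denominator_quotient:
  "(\<Prod>t<p. qK ^ p - qK ^ t) * (\<Prod>t=p + c..<p + c + r. qK ^ p - qK ^ Suc t)
     / (\<Prod>s\<in>{..p + r} - {p}. qK ^ p - qK ^ s) = qfac (c + r) / (qfac c * qfac r)"
proof -
  have nz: "(\<Prod>t<p. qK ^ p - qK ^ t) \<noteq> 0" by auto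
  have "{..p + r} - {p} = {..<p} \<union> {p<..p + r}" by auto
  moreover have "(\<Prod>s\<in>{..<p} \<union> {p<..p + r}. qK ^ p - qK ^ s)
    = (\<Prod>t<p. qK ^ p - qK ^ t) * (\<Prod>s\<in>{p<..p + r}. qK ^ p - qK ^ s)"
    by (rule prod.union_disjoint) auto
  ultimately have "(\<Prod>s\<in>{..p + r} - {p}. qK ^ p - qK ^ s)
    = (\<Prod>t<p. qK ^ p - qK ^ t) * (\<Prod>s\<in>{p<..p + r}. qK ^ p - qK ^ s)"
    by simp
  also have "(\<Prod>s\<in>{p<..p + r}. qK ^ p - qK ^ s) = (\<Prod>m<r. qK ^ p * (1 - qK ^ Suc m))"
    by (intro prod.reindex_bij_witness[of _ "\<lambda>m. p + Suc m" "\<lambda>s. s - Suc p"])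
      (auto simp: algebra_simps simp flip: power_add power_Suc)
  also have "\<dots> = qK ^ (p * r) * qfac r"
    by (simp add: prod.distrib qfac_def power_mult)
  finally have den: "(\<Prod>s\<in>{..p + r} - {p}. qK ^ p - qK ^ s)
    = (\<Prod>t<p. qK ^ p - qK ^ t) * (qK ^ (p * r) * qfac r)" .
  have "(\<Prod>t=p + c..<p + c + r. qK ^ p - qK ^ Suc t) = (\<Prod>m<r. qK ^ p * (1 - qK ^ (c + Suc m)))"
    by (intro prod.reindex_bij_witness[of _ "\<lambda>m. p + c + m" "\<lambda>s. s - (p + c)"])
      (auto simp: algebra_simps simp flip: power_add power_Suc)
  also have "\<dots> = qK ^ (p * r) * (\<Prod>m<r. 1 - qK ^ (c + Suc m))"
    by (simp add: prod.distrib power_mult del: power_Suc)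
  finally have num: "(\<Prod>t=p + c..<p + c + r. qK ^ p - qK ^ Suc t)
     = qK ^ (p * r) * (\<Prod>m<r. 1 - qK ^ (c + Suc m))" .
  show ?thesis unfolding den num using nz by (simp add: qfac_add del: power_Suc)
qed

text \<open>The runs from \<open>pair_factor_chain\<close> cancel the Lagrange denominators up to
  one q-binomial coefficient per place, and these multiply to the q-multinomial coefficient. The
  inversion sign of the order and the divisors \<open>y (c l)\<close> survive.\<close>

lemma chain_term:
  assumes pos: "\<And>j. 1 \<le> j \<Longrightarrow> j \<le> n \<Longrightarrow> 1 \<le> a j" and bij: "bij_betw \<pi> {..n} {..n}"
  defines "\<alpha> \<equiv> chain n a \<pi>" and "N \<equiv> \<Sum>i\<le>n. a i"
  shows "(\<Prod>j\<le>n. \<Prod>i<j. pair_factor a (\<lambda>i. qK ^ \<alpha> i) i j)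
      / (\<Prod>i\<le>n. \<Prod>s\<in>{..N - a i} - {\<alpha> i}. qK ^ \<alpha> i - qK ^ s)
    = (\<Prod>l\<le>n. \<Prod>k<l. if \<pi> k < \<pi> l then 1 else - 1) * (qfac N / (\<Prod>i\<le>n. qfac (a i)))
      / (\<Prod>l\<le>n. \<Prod>k<l. qK ^ (\<Sum>t<k. a (\<pi> t)) - qK ^ (\<Sum>t<Suc l. a (\<pi> t)))"
proof -
  define c where "c k = a (\<pi> k)" for k
  define P where "P k = (\<Sum>t<k. c t)" for k
  define A where "A k l = (\<Prod>m<c k. qK ^ P l - qK ^ (P k + m))" for k l
  define B where "B k l = (\<Prod>m<c l. qK ^ P k - qK ^ Suc (P l + m))" for k l
  have \<pi>n: "\<pi> k \<le> n" if "k \<le> n" for k using bij that by (auto simp: bij_betw_def)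
  have \<alpha>: "\<alpha> (\<pi> k) = P k" if "k \<le> n" for k
    using chain_apply[OF bij that] by (simp add: \<alpha>_def P_def c_def)
  have N: "P (Suc n) = N"
    using sum_perm_atMost[OF bij, of a] by (simp add: N_def P_def c_def lessThan_Suc_atMost)
  have PS: "P (Suc k) = P k + c k" for k by (simp add: P_def)
  have mono: "P k \<le> P l" if "k \<le> l" for k l
    unfolding P_def using that by (intro sum_mono2) auto
  have "(\<Prod>j\<le>n. \<Prod>i<j. pair_factor a (\<lambda>i. qK ^ \<alpha> i) i j)
     = (\<Prod>l\<le>n. \<Prod>k<l. (if \<pi> k < \<pi> l then 1 else - 1) * A k l * B k l / (qK ^ P k - qK ^ P (Suc l)))"
  proof (subst prod_pairs_perm[OF bij], intro prod.cong refl)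
    fix l k assume "l \<in> {..n}" "k \<in> {..<l}"
    then have kl: "k < l" "l \<le> n" by auto
    have ne: "\<pi> k \<noteq> \<pi> l" using bij kl by (auto simp: bij_betw_def inj_on_def)
    show "(if \<pi> k < \<pi> l then pair_factor a (\<lambda>i. qK ^ \<alpha> i) (\<pi> k) (\<pi> l)
        else pair_factor a (\<lambda>i. qK ^ \<alpha> i) (\<pi> l) (\<pi> k))
      = (if \<pi> k < \<pi> l then 1 else - 1) * A k l * B k l / (qK ^ P k - qK ^ P (Suc l))"
      unfolding A_def B_def P_def using kl \<alpha>[of k] \<alpha>[of l] ne \<pi>n[of k] \<pi>n[of l]
      by (intro pair_factor_chain pos) (auto simp: c_def P_def)
  qed
  also have "\<dots> = (\<Prod>l\<le>n. \<Prod>k<l. if \<pi> k < \<pi> l then 1 else - 1)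
     * ((\<Prod>l\<le>n. \<Prod>k<l. A k l) * (\<Prod>l\<le>n. \<Prod>k<l. B k l))
     / (\<Prod>l\<le>n. \<Prod>k<l. qK ^ P k - qK ^ P (Suc l))"
    by (simp add: prod.distrib prod_dividef mult.assoc)
  finally have num: "(\<Prod>j\<le>n. \<Prod>i<j. pair_factor a (\<lambda>i. qK ^ \<alpha> i) i j)
     = (\<Prod>l\<le>n. \<Prod>k<l. if \<pi> k < \<pi> l then 1 else - 1)
     * ((\<Prod>l\<le>n. \<Prod>k<l. A k l) * (\<Prod>l\<le>n. \<Prod>k<l. B k l))
     / (\<Prod>l\<le>n. \<Prod>k<l. qK ^ P k - qK ^ P (Suc l))" .
  \<comment> \<open>The runs are collected in opposite directions: for fixed l the
    \<open>A k l\<close> fill the range below \<open>P l\<close>, for fixed k the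
    \<open>B k l\<close> fill the range from \<open>P (Suc k)\<close> to N.\<close>
  have "(\<Prod>k<l. A k l) = (\<Prod>t<P l. qK ^ P l - qK ^ t)" for l
    using prod_blocks[of 0 l "\<lambda>t. qK ^ P l - qK ^ t" c]
    by (simp add: A_def P_def atLeast0LessThan)
  moreover have "(\<Prod>l\<le>n. \<Prod>k<l. B k l) = (\<Prod>k\<le>n. \<Prod>l=Suc k..n. B k l)"
    unfolding prod.nested_swap' by (simp flip: lessThan_Suc_atMost)
  moreover have "(\<Prod>l=Suc k..n. B k l) = (\<Prod>t=P (Suc k)..<N. qK ^ P k - qK ^ Suc t)" if "k \<le> n" for k
    using prod_blocks[of "Suc k" "Suc n" "\<lambda>t. qK ^ P k - qK ^ Suc t" c] that
    by (simp add: B_def P_def[symmetric] atLeastLessThanSuc_atLeastAtMost PS flip: N del: power_Suc prod.op_ivl_Suc)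
  ultimately have AB: "(\<Prod>l\<le>n. \<Prod>k<l. A k l) * (\<Prod>l\<le>n. \<Prod>k<l. B k l)
     = (\<Prod>k\<le>n. (\<Prod>t<P k. qK ^ P k - qK ^ t) * (\<Prod>t=P (Suc k)..<N. qK ^ P k - qK ^ Suc t))"
    by (simp add: prod.distrib del: power_Suc)
  have "(\<Prod>i\<le>n. \<Prod>s\<in>{..N - a i} - {\<alpha> i}. qK ^ \<alpha> i - qK ^ s)
     = (\<Prod>k\<le>n. \<Prod>s\<in>{..N - a (\<pi> k)} - {\<alpha> (\<pi> k)}. qK ^ \<alpha> (\<pi> k) - qK ^ s)"
    by (rule prod.reindex_bij_betw[OF bij, symmetric])
  also have "\<dots> = (\<Prod>k\<le>n. \<Prod>s\<in>{..N - c k} - {P k}. qK ^ P k - qK ^ s)"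
    by (intro prod.cong) (auto simp: \<alpha> c_def)
  finally have den: "(\<Prod>i\<le>n. \<Prod>s\<in>{..N - a i} - {\<alpha> i}. qK ^ \<alpha> i - qK ^ s)
     = (\<Prod>k\<le>n. \<Prod>s\<in>{..N - c k} - {P k}. qK ^ P k - qK ^ s)" .
  have "((\<Prod>l\<le>n. \<Prod>k<l. A k l) * (\<Prod>l\<le>n. \<Prod>k<l. B k l))
      / (\<Prod>i\<le>n. \<Prod>s\<in>{..N - a i} - {\<alpha> i}. qK ^ \<alpha> i - qK ^ s)
    = (\<Prod>k\<le>n. qfac (N - P k) / (qfac (c k) * qfac (N - P (Suc k))))"
    unfolding AB den prod_dividef[symmetric]
  proof (intro prod.cong refl)
    fix k assume "k \<in> {..n}"
    then have "P (Suc k) \<le> N" using mono[of "Suc k" "Suc n"] N by simp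
    then obtain r where r: "N = P k + c k + r" by (auto simp: P_def le_iff_add)
    show "(\<Prod>t<P k. qK ^ P k - qK ^ t) * (\<Prod>t=P (Suc k)..<N. qK ^ P k - qK ^ Suc t)
        / (\<Prod>s\<in>{..N - c k} - {P k}. qK ^ P k - qK ^ s)
      = qfac (N - P k) / (qfac (c k) * qfac (N - P (Suc k)))"
      using lagrange_denominator_quotient[of "P k" "c k" r] r by (simp add: P_def del: power_Suc)
  qed
  also have "\<dots> = (\<Prod>k<Suc n. qfac (N - P k) / qfac (N - P (Suc k))) / (\<Prod>k\<le>n. qfac (c k))"
    by (simp add: prod_dividef prod.distrib lessThan_Suc_atMost mult_ac)
  also have "(\<Prod>k<m. qfac (N - P k) / qfac (N - P (Suc k))) = qfac (N - P 0) / qfac (N - P m)" for m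
    by (induction m) simp_all
  also have "qfac (N - P 0) / qfac (N - P (Suc n)) = qfac N"
    unfolding N by (simp add: P_def) (simp add: qfac_def)
  also have "(\<Prod>k\<le>n. qfac (c k)) = (\<Prod>i\<le>n. qfac (a i))"
    unfolding c_def by (rule prod.reindex_bij_betw[OF bij])
  finally have "((\<Prod>l\<le>n. \<Prod>k<l. A k l) * (\<Prod>l\<le>n. \<Prod>k<l. B k l))
      / (\<Prod>i\<le>n. \<Prod>s\<in>{..N - a i} - {\<alpha> i}. qK ^ \<alpha> i - qK ^ s)
    = qfac N / (\<Prod>i\<le>n. qfac (a i))" .
  then show ?thesis
    unfolding num by (simp add: P_def c_def mult_ac divide_simps)
qed

lemma prod_linear_factors:
  fixes z :: "'b \<Rightarrow> 'a :: idom"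
  assumes "finite A"
  shows "lead_coeff (\<Prod>t\<in>A. [:- z t, 1:]) = 1" "degree (\<Prod>t\<in>A. [:- z t, 1:]) = card A"
  using assms by (simp only: lead_coeff_prod, simp) (simp add: degree_prod_eq_sum_degree)

subsection \<open>The tournament\<close>

lemma beats_irrefl: "\<not> beats Q i i"
  by (simp add: beats_def)

lemma beats_total: "i \<noteq> j \<Longrightarrow> beats Q i j \<or> beats Q j i"
  by (auto simp: beats_def)

lemma beats_asym: "beats Q i j \<Longrightarrow> \<not> beats Q j i"
  by (auto simp: beats_def)

definition prefactor :: "(nat \<times> nat) set \<Rightarrow> nat \<Rightarrow> int" where
  "prefactor Q k = ratio 0 2 k + (\<Sum>p\<in>Q. ratio (snd p) (fst p) k)"

lemma finite_tourn:
  "Q \<subseteq> {(i, j). 3 \<le> i \<and> i < j \<and> j \<le> n} \<Longrightarrow> finite (Q :: (nat \<times> nat) set)"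
  by (rule finite_subset[of _ "{..n} \<times> {..n}"]) auto

lemma prefactor_eq_card:
  assumes "finite Q"
  shows "prefactor Q k = ratio 0 2 k + int (card {p\<in>Q. snd p = k}) - int (card {p\<in>Q. fst p = k})"
proof -
  have "(\<Sum>p\<in>Q. ratio (snd p) (fst p) k) = (\<Sum>p\<in>Q. if snd p = k then 1 else 0) - (\<Sum>p\<in>Q. if fst p = k then 1 else 0)"
    unfolding sum_subtractf[symmetric] by (intro sum.cong) (auto simp: ratio_apply)
  also have "\<dots> = int (card {p\<in>Q. snd p = k}) - int (card {p\<in>Q. fst p = k})"
    using assms by (simp flip: sum.inter_filter)
  finally show ?thesis by (simp add: prefactor_def)
qed

locale dyson_tournament =
  fixes n :: nat and a :: "nat \<Rightarrow> nat" and Q :: "(nat \<times> nat) set"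
  assumes n: "3 \<le> n" and Q: "Q \<subseteq> {(i, j). 3 \<le> i \<and> i < j \<and> j \<le> n}"
    and pos: "\<And>j. 1 \<le> j \<Longrightarrow> j \<le> n \<Longrightarrow> 1 \<le> a j"
begin

definition F :: lser where "F = lmul (lmono (prefactor Q)) (Dn n a)"

definition N :: nat where "N = (\<Sum>i\<le>n. a i)"

text \<open>The score of i for i = 1 and i at least 3. Index 2 would have score n - 2 and loses one
  unit through x_0 / x_2; index 0, which would beat all n players, gains one.\<close>

definition w :: "nat \<Rightarrow> nat" where
  "w i = (if i = 0 then n + 1 else if i = 1 then n - 1 else if i = 2 then n - 3
    else card {j\<in>{1..n}. beats Q i j})"

lemma QD: "(i, j) \<in> Q \<Longrightarrow> 3 \<le> i \<and> i < j \<and> j \<le> n"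
  using Q by auto

text \<open>n - i is the score of i if smaller labels always win. Each pair (i, j) in
  \<open>Q\<close> takes one win from i and gives it to j, and its factor x_j / x_i does the same to
  the exponents.\<close>

lemma w_eq:
  assumes i: "i \<le> n"
  shows "int (w i) = int (n - i) + prefactor Q i"
proof (cases "3 \<le> i")
  case False
  have no: "{p\<in>Q. snd p = i} = {}" "{p\<in>Q. fst p = i} = {}" using False QD by force+
  consider "i = 0" | "i = 1" | "i = 2" using False by linarith
  then show ?thesis
    using n unfolding prefactor_eq_card[OF finite_tourn[OF Q]] no
    by cases (auto simp: w_def ratio_apply)
next
  case True
  define U where "U = {j\<in>{i<..n}. (i, j) \<in> Q}"
  define V where "V = {j\<in>{1..<i}. (j, i) \<in> Q}"
  have "{j\<in>{1..n}. beats Q i j} = V \<union> ({i<..n} - U)"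
    using True i by (auto simp: beats_def U_def V_def)
  moreover have "card (V \<union> ({i<..n} - U)) = card V + card ({i<..n} - U)"
    by (rule card_Un_disjoint) (auto simp: V_def)
  moreover have U: "U \<subseteq> {i<..n}" by (auto simp: U_def)
  moreover have "card ({i<..n} - U) = (n - i) - card U" "card U \<le> n - i"
    using card_mono[OF _ U] finite_subset[OF U] U by (simp_all add: card_Diff_subset)
  moreover have "card {p\<in>Q. snd p = i} = card V"
    using QD True by (intro bij_betw_same_card[of fst] bij_betw_byWitness[where f' = "\<lambda>j. (j, i)"]) (force simp: V_def)+
  moreover have "card {p\<in>Q. fst p = i} = card U"
    using QD True by (intro bij_betw_same_card[of snd] bij_betw_byWitness[where f' = "\<lambda>j. (i, j)"]) (force simp: U_def)+
  ultimately show ?thesis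
    using True unfolding prefactor_eq_card[OF finite_tourn[OF Q]]
    by (simp add: w_def ratio_apply)
qed

lemma lsupp_F:
  assumes "e \<in> lsupp F"
  obtains d where "d \<in> lsupp (Dn n a)" "e = (\<lambda>k. prefactor Q k + d k)"
  using assms by (auto simp: F_def lsupp_lmono elim: lsupp_lmulE)

text \<open>By \<open>w_eq\<close> the powers of the nodes coming from the monomial, from D_n and
  from the interpolation weights cancel, so only linear forms and values of \<open>\<psi>\<close>
  remain.\<close>

lemma CT_node_sum:
  assumes psi: "\<And>i. i \<le> n \<Longrightarrow> lead_coeff (\<psi> i) = 1" "\<And>i. i \<le> n \<Longrightarrow> degree (\<psi> i) = w i"
  shows "CT F = (\<Sum>\<alpha>\<in>PiE {..n} (\<lambda>i. {..N - a i}).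
     (\<Prod>j\<le>n. \<Prod>i<j. pair_factor a (\<lambda>i. qK ^ \<alpha> i) i j)
       / (\<Prod>i\<le>n. \<Prod>s\<in>{..N - a i} - {\<alpha> i}. qK ^ \<alpha> i - qK ^ s)
       * (\<Prod>i\<le>n. poly (\<psi> i) (qK ^ \<alpha> i)))"
proof -
  have fin: "finite (lsupp (Dn n a))"
    using leval_Dn(1)[of n a "\<lambda>_. 1", OF pos] by simp
  have finF: "finite (lsupp F)"
    unfolding F_def by (intro finite_lsupp_lmul fin) (simp add: lsupp_lmono)
  have bd: "fst p \<le> n" "snd p \<le> n" if "p \<in> Q" for p
    using QD[of "fst p" "snd p"] that by auto
  have out: "prefactor Q k = 0" if "n < k" for k
    using that n bd by (force simp: prefactor_def ratio_apply intro!: sum.neutral)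
  have tot: "(\<Sum>k\<le>n. prefactor Q k) = 0"
  proof -
    have "(\<Sum>k\<le>n. ratio i j k) = 0" if "i \<le> n" "j \<le> n" for i j
      using that by (simp add: ratio_apply sum_subtractf sum.delta)
    then show ?thesis
      using n bd unfolding prefactor_def sum.distrib
      by (subst sum.swap) simp
  qed
  have aN: "a i \<le> N" if "i \<le> n" for i
    unfolding N_def using that by (intro member_le_sum) auto
  have "CT F = (\<Sum>\<alpha>\<in>PiE {..n} (\<lambda>i. {..N - a i}).
     leval n (\<lambda>i. qK ^ \<alpha> i) F * (\<Prod>i\<le>n. poly (\<psi> i) (qK ^ \<alpha> i)
        * (qK ^ \<alpha> i) powi (int (N - a i) - int (w i)) / (\<Prod>s\<in>{..N - a i} - {\<alpha> i}. qK ^ \<alpha> i - qK ^ s)))"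
  proof (rule CT_interpolation[OF finF _ _ psi], goal_cases)
    case (5 e)
    then show ?case
      using tot lsupp_Dn_total[OF pos] by (auto elim!: lsupp_F simp: sum.distrib)
  next
    case (6 e k)
    then show ?case
      using out lsupp_Dn_outside[OF pos] by (auto elim!: lsupp_F)
  next
    case (7 e i)
    then obtain d where d: "d \<in> lsupp (Dn n a)" "e = (\<lambda>k. prefactor Q k + d k)"
      by (auto elim: lsupp_F)
    have "int (n - i) - (\<Sum>i\<le>n. int (a i)) + int (a i) \<le> d i"
      using 7 d by (intro lsupp_Dn_lower pos) auto
    then show ?case
      using d w_eq[OF 7(2)] aN[OF 7(2)] by (simp add: N_def of_nat_diff)
  qed (auto simp: inj_def)
  also have "\<dots> = (\<Sum>\<alpha>\<in>PiE {..n} (\<lambda>i. {..N - a i}).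
     (\<Prod>j\<le>n. \<Prod>i<j. pair_factor a (\<lambda>i. qK ^ \<alpha> i) i j)
       / (\<Prod>i\<le>n. \<Prod>s\<in>{..N - a i} - {\<alpha> i}. qK ^ \<alpha> i - qK ^ s)
       * (\<Prod>i\<le>n. poly (\<psi> i) (qK ^ \<alpha> i)))"
  proof (intro sum.cong refl)
    fix \<alpha> assume "\<alpha> \<in> PiE {..n} (\<lambda>i. {..N - a i})"
    define c where "c i = qK ^ \<alpha> i" for i
    have c: "c i \<noteq> 0" for i by (simp add: c_def)
    have "leval n c F = (\<Prod>j\<le>n. \<Prod>i<j. pair_factor a c i j)
       * ((\<Prod>k\<le>n. c k powi prefactor Q k)
       * (\<Prod>k\<le>n. c k powi (int (n - k) - (\<Sum>i\<le>n. int (a i)) + int (a k))))"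
      unfolding F_def using c fin
      by (simp add: leval_lmul leval_Dn_pair_factor[OF pos] leval_lmono lsupp_lmono mult_ac)
    then have "leval n c F * (\<Prod>k\<le>n. c k powi (int (N - a k) - int (w k)))
      = (\<Prod>j\<le>n. \<Prod>i<j. pair_factor a c i j) * (\<Prod>k\<le>n. c k powi prefactor Q k
       * c k powi (int (n - k) - (\<Sum>i\<le>n. int (a i)) + int (a k)) * c k powi (int (N - a k) - int (w k)))"
      by (simp add: prod.distrib mult_ac)
    also have "(\<Prod>k\<le>n. c k powi prefactor Q k
       * c k powi (int (n - k) - (\<Sum>i\<le>n. int (a i)) + int (a k)) * c k powi (int (N - a k) - int (w k))) = 1"
    proof (intro prod.neutral ballI)
      fix k assume "k \<in> {..n}"
      then have "prefactor Q k + (int (n - k) - (\<Sum>i\<le>n. int (a i)) + int (a k)) + (int (N - a k) - int (w k)) = 0"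
        using w_eq[of k] aN[of k] by (simp add: N_def of_nat_diff)
      then show "c k powi prefactor Q k
         * c k powi (int (n - k) - (\<Sum>i\<le>n. int (a i)) + int (a k)) * c k powi (int (N - a k) - int (w k)) = 1"
        by (simp only: power_int_add[OF disjI1[OF c], symmetric] power_int_0_right)
    qed
    finally have eq: "leval n c F * (\<Prod>k\<le>n. c k powi (int (N - a k) - int (w k)))
      = (\<Prod>j\<le>n. \<Prod>i<j. pair_factor a c i j)" by simp
    have "leval n c F * (\<Prod>i\<le>n. poly (\<psi> i) (c i)
        * c i powi (int (N - a i) - int (w i)) / (\<Prod>s\<in>{..N - a i} - {\<alpha> i}. c i - qK ^ s))
      = (leval n c F * (\<Prod>i\<le>n. c i powi (int (N - a i) - int (w i))))
         / (\<Prod>i\<le>n. \<Prod>s\<in>{..N - a i} - {\<alpha> i}. c i - qK ^ s) * (\<Prod>i\<le>n. poly (\<psi> i) (c i))"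
      by (simp only: prod.distrib prod_dividef) simp
    then show "leval n (\<lambda>i. qK ^ \<alpha> i) F * (\<Prod>i\<le>n. poly (\<psi> i) (qK ^ \<alpha> i)
        * (qK ^ \<alpha> i) powi (int (N - a i) - int (w i)) / (\<Prod>s\<in>{..N - a i} - {\<alpha> i}. qK ^ \<alpha> i - qK ^ s))
      = (\<Prod>j\<le>n. \<Prod>i<j. pair_factor a (\<lambda>i. qK ^ \<alpha> i) i j)
       / (\<Prod>i\<le>n. \<Prod>s\<in>{..N - a i} - {\<alpha> i}. qK ^ \<alpha> i - qK ^ s)
       * (\<Prod>i\<le>n. poly (\<psi> i) (qK ^ \<alpha> i))"
      unfolding eq by (simp add: c_def[abs_def])
  qed
  finally show ?thesis .
qed

section \<open>Removing losers from a nontransitive tournament\<close>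

lemma not_beats_1: "\<not> beats Q i 1" if "1 \<le> i"
  using that QD by (force simp: beats_def)

lemma beats_2D: "beats Q i 2 \<Longrightarrow> 1 \<le> i \<Longrightarrow> i = 1"
  using QD by (force simp: beats_def)

text \<open>The entries are listed in the order of removal, so \<open>s ! 0\<close> is destined for
  the last place. Labels below 3 are never removed.\<close>

definition peel :: "nat list \<Rightarrow> bool" where
  "peel s \<longleftrightarrow> distinct s \<and> set s \<subseteq> {3..n}
    \<and> (\<forall>t<length s. \<forall>i\<in>{1..n} - set (take (Suc t) s). beats Q i (s ! t))"

lemma peel_beaten:
  assumes "peel s" "t < length s" "beats Q (s ! t) x" "x \<in> {1..n}"
  obtains u where "u < t" "x = s ! u"
proof -
  have "x \<noteq> s ! t" using assms(3) beats_irrefl by auto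
  moreover have "x \<in> set (take (Suc t) s)"
    using assms beats_asym by (force simp: peel_def)
  ultimately have "x \<in> set (take t s)"
    using assms(2) by (simp add: take_Suc_conv_app_nth)
  then show ?thesis
    using assms(2) by (auto simp: in_set_conv_nth intro: that)
qed

text \<open>Whomever a removed player beats was removed earlier, so along a cycle the times of
  removal would decrease forever.\<close>

lemma peel_avoids_cycle:
  assumes s: "peel s" and cyc: "i \<in> {1..n}" "j \<in> {1..n}" "k \<in> {1..n}"
    "beats Q i j" "beats Q j k" "beats Q k i"
  shows "i \<notin> set s"
proof
  assume "i \<in> set s"
  then obtain t where t: "t < length s" "i = s ! t" by (auto simp: in_set_conv_nth)
  obtain u where u: "u < t" "j = s ! u"
    using peel_beaten[OF s t(1), of j] t cyc by auto
  obtain v where v: "v < u" "k = s ! v"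
    using peel_beaten[OF s, of u k] t u cyc by auto
  obtain x where "x < v" "i = s ! x"
    using peel_beaten[OF s, of v i] t u v cyc by auto
  with t u v s show False by (auto simp: peel_def nth_eq_iff_index_eq)
qed

text \<open>Take a removal list of maximal length: a remaining player from 3 on who beats no
  remaining one could be appended. A cycle keeps three labels from 3 on out of the list, which gives
  the length bound.\<close>

lemma nontransitive_peel:
  assumes "\<not> transitive_tourn n Q"
  obtains s where "peel s" "length s + 5 \<le> n"
    "\<And>i. i \<in> {3..n} - set s \<Longrightarrow> \<exists>j\<in>{1..n} - set s. beats Q i j"
proof -
  have "peel []" by (simp add: peel_def)
  moreover have "\<forall>s. peel s \<longrightarrow> length s < Suc n"
  proof (intro allI impI)
    fix s assume s: "peel s"
    have "card (set s) \<le> card {3..n}" using s by (intro card_mono) (auto simp: peel_def)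
    moreover have "card (set s) = length s" using s by (simp add: peel_def distinct_card)
    ultimately show "length s < Suc n" by simp
  qed
  ultimately obtain s where s: "peel s" and max: "\<And>s'. peel s' \<Longrightarrow> length s' \<le> length s"
    using ex_has_greatest_nat[of peel "[]" length "Suc n"] by metis
  obtain i j k where ijk: "i \<in> {1..n}" "j \<in> {1..n}" "k \<in> {1..n}"
    "beats Q i j" "beats Q j k" "beats Q k i"
    using assms by (auto simp: transitive_tourn_def)
  have ge: "x \<in> {3..n}" if "x \<in> {1..n}" "y \<in> {1..n}" "z \<in> {1..n}"
    "beats Q x y" "beats Q y z" "beats Q z x" for x y z
  proof -
    have "x \<noteq> 1" using that not_beats_1[of z] by auto
    moreover have "x \<noteq> 2" using that beats_2D[of z] not_beats_1[of y] by auto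
    ultimately show ?thesis using that by auto
  qed
  have dist: "i \<noteq> j" "j \<noteq> k" "k \<noteq> i" using ijk beats_irrefl by auto
  have "set s \<union> {i, j, k} \<subseteq> {3..n}"
    using s ge[of i j k] ge[of j k i] ge[of k i j] ijk by (auto simp: peel_def)
  then have "card (set s \<union> {i, j, k}) \<le> card {3..n}" by (intro card_mono) auto
  moreover have "card (set s \<union> {i, j, k}) = card (set s) + card {i, j, k}"
    using peel_avoids_cycle[OF s, of i j k] peel_avoids_cycle[OF s, of j k i]
      peel_avoids_cycle[OF s, of k i j] ijk
    by (intro card_Un_disjoint) auto
  moreover have "card (set s) = length s" "card {i, j, k} = 3"
    using s dist by (auto simp: peel_def distinct_card)
  ultimately have len: "length s + 5 \<le> n" using n by simp
  have stuck: "\<exists>j\<in>{1..n} - set s. beats Q i j" if i: "i \<in> {3..n} - set s" for i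
  proof (rule ccontr)
    assume no: "\<not> (\<exists>j\<in>{1..n} - set s. beats Q i j)"
    have "peel (s @ [i])"
      unfolding peel_def
    proof (intro conjI allI impI ballI)
      show "distinct (s @ [i])" "set (s @ [i]) \<subseteq> {3..n}" using s i by (auto simp: peel_def)
      fix t j assume t: "t < length (s @ [i])" and j: "j \<in> {1..n} - set (take (Suc t) (s @ [i]))"
      show "beats Q j ((s @ [i]) ! t)"
      proof (cases "t < length s")
        case True
        then show ?thesis using s j by (simp add: peel_def nth_append)
      next
        case False
        then have "t = length s" using t by simp
        then show ?thesis using no j beats_total[of i j Q] by auto
      qed
    qed
    from max[OF this] show False by simp
  qed
  show ?thesis using that[OF s len stuck] .
qed

text \<open>With m removals, everybody outside \<open>s\<close> can afford m + 1 roots and is banned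
  from the last m + 1 places. The members of \<open>s\<close> are forced into the last m places, so
  nobody is left for place n - m.\<close>

lemma CT_nontransitive:
  assumes "\<not> transitive_tourn n Q"
  shows "CT F = 0"
proof -
  obtain s where s: "peel s" and len: "length s + 5 \<le> n"
    and stuck: "\<And>i. i \<in> {3..n} - set s \<Longrightarrow> \<exists>j\<in>{1..n} - set s. beats Q i j"
    using nontransitive_peel[OF assms] by metis
  define m where "m = length s"
  have dist: "distinct s" and sub: "set s \<subseteq> {3..n}" using s by (auto simp: peel_def)
  have inj: "inj_on ((!) s) {..<m}" using dist by (auto simp: m_def inj_on_def nth_eq_iff_index_eq)
  have im: "(!) s ` {..<m} = set s" by (auto simp: m_def in_set_conv_nth)
  \<comment> \<open>\<open>s ! u\<close> needs exactly u roots, to stay out of the places destined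
    for the u players removed before it, all of whom it beats.\<close>
  define r where "r i = (if i \<in> set s then inv_into {..<m} ((!) s) i else m + 1)" for i
  have rs: "r (s ! u) = u" if "u < m" for u
    using that inj by (simp add: r_def m_def inv_into_f_f)
  have rw: "r i \<le> w i" if i: "i \<le> n" for i
  proof (cases "i \<in> set s")
    case True
    then obtain t where t: "t < m" "i = s ! t" by (auto simp: m_def in_set_conv_nth)
    have "(!) s ` {..<t} \<subseteq> {j\<in>{1..n}. beats Q i j}"
    proof
      fix x assume "x \<in> (!) s ` {..<t}"
      then obtain u where u: "u < t" "x = s ! u" by auto
      have "i \<notin> set (take (Suc u) s)"
        using t u dist by (auto simp: m_def in_set_conv_nth nth_eq_iff_index_eq)
      moreover have "x \<in> set s" "i \<in> set s" using t u by (auto simp: m_def)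
      then have "x \<in> {3..n}" "i \<in> {3..n}" using sub by blast+
      ultimately show "x \<in> {j\<in>{1..n}. beats Q i j}"
        using s t u by (auto simp: peel_def m_def)
    qed
    then have "card ((!) s ` {..<t}) \<le> card {j\<in>{1..n}. beats Q i j}" by (intro card_mono) auto
    moreover have "card ((!) s ` {..<t}) = t"
      using t by (subst card_image) (auto intro: inj_on_subset[OF inj])
    moreover have "3 \<le> i" using sub True by auto
    ultimately show ?thesis using rs[OF t(1)] t by (simp add: w_def)
  next
    case False
    show ?thesis
    proof (cases "3 \<le> i")
      case True
      then obtain j where j: "j \<in> {1..n} - set s" "beats Q i j" using stuck[of i] False i by auto
      \<comment> \<open>A remaining player beats all m removed ones and, the list being stuck, at
        least one more.\<close>
      have "insert j (set s) \<subseteq> {j\<in>{1..n}. beats Q i j}"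
      proof
        fix x assume "x \<in> insert j (set s)"
        moreover have "beats Q i (s ! t)" if "t < length s" for t
        proof -
          have "i \<in> {1..n} - set (take (Suc t) s)"
            using True i False in_set_takeD[of i "Suc t" s] by auto
          then show ?thesis using s that unfolding peel_def by blast
        qed
        ultimately show "x \<in> {j\<in>{1..n}. beats Q i j}"
          using j sub nth_mem[of _ s] by (fastforce simp: in_set_conv_nth)
      qed
      then have "card (insert j (set s)) \<le> card {j\<in>{1..n}. beats Q i j}" by (intro card_mono) auto
      then show ?thesis using j dist True False by (simp add: w_def r_def m_def distinct_card)
    next
      case False
      then show ?thesis using len sub by (auto simp: w_def r_def m_def)
    qed
  qed
  define \<psi> where "\<psi> i = (\<Prod>t<r i. [:- (qK ^ (N - a i - (\<Sum>u<t. a (s ! u)))), 1:]) * monom 1 (w i - r i)" for i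
  have psi: "lead_coeff (\<psi> i) = 1" "degree (\<psi> i) = w i" if "i \<le> n" for i
  proof -
    show "lead_coeff (\<psi> i) = 1"
      unfolding \<psi>_def lead_coeff_mult prod_linear_factors(1)[OF finite_lessThan]
      by (simp add: degree_monom_eq)
    show "degree (\<psi> i) = w i"
      unfolding \<psi>_def using rw[OF that]
      by (subst degree_mult_eq) (auto simp: prod_linear_factors degree_monom_eq)
  qed
  show ?thesis
  proof (rule trans[OF CT_node_sum[of \<psi>]], fact psi(1), fact psi(2), rule sum.neutral, rule ballI, rule ccontr)
    fix \<alpha> assume \<alpha>: "\<alpha> \<in> PiE {..n} (\<lambda>i. {..N - a i})"
      and nz: "(\<Prod>j\<le>n. \<Prod>i<j. pair_factor a (\<lambda>i. qK ^ \<alpha> i) i j)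
       / (\<Prod>i\<le>n. \<Prod>s\<in>{..N - a i} - {\<alpha> i}. qK ^ \<alpha> i - qK ^ s)
       * (\<Prod>i\<le>n. poly (\<psi> i) (qK ^ \<alpha> i)) \<noteq> 0"
    have "(\<Prod>j\<le>n. \<Prod>i<j. pair_factor a (\<lambda>i. qK ^ \<alpha> i) i j) \<noteq> 0" using nz by auto
    then obtain \<pi> where bij: "bij_betw \<pi> {..n} {..n}" and ch: "\<alpha> = chain n a \<pi>"
      using nonvanishing_node_is_chain[of n a \<alpha>] pos \<alpha> unfolding N_def by metis
    have nz': "poly (\<psi> (\<pi> k)) (qK ^ chain n a \<pi> (\<pi> k)) \<noteq> 0" if "k \<le> n" for k
    proof -
      have "\<pi> k \<le> n" using that bij by (auto simp: bij_betw_def)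
      then show ?thesis using nz by (auto simp: ch)
    qed
    have root: "poly (\<psi> i) (qK ^ ((\<Sum>i\<le>n. a i) - a i - (\<Sum>u<t. a (s ! u)))) = 0" if "t < r i" for i t
      using that by (auto simp: \<psi>_def poly_prod N_def intro!: bexI[of _ t])
    have ro: "m \<le> r i" if "i \<notin> (!) s ` {..<m}" for i
      using that im by (simp add: r_def)
    have mn: "m \<le> n" using len by (simp add: m_def)
    have tail: "\<pi> (n - t) = s ! t" if "t < m" for t
      using chain_tail_forced(1)[of \<pi> n r \<psi> a "(!) s" m t] bij root nz' rs ro mn that by blast
    \<comment> \<open>Place n - m admits only an index with at most m roots, hence a member of
      \<open>s\<close>, but these all occupy later places.\<close>
    have last: "r (\<pi> (n - m)) \<le> m"
      using chain_tail_forced(2)[of \<pi> n r \<psi> a "(!) s" m] bij root nz' rs ro mn by blast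
    then have "\<pi> (n - m) \<in> set s" by (auto simp: r_def split: if_splits)
    then obtain u where u: "u < m" "\<pi> (n - m) = s ! u" by (auto simp: m_def in_set_conv_nth)
    then have "\<pi> (n - m) = \<pi> (n - u)" using tail by simp
    then have "n - m = n - u" using bij by (auto simp: bij_betw_def inj_on_def)
    then show False using u mn by simp
  qed
qed

end

subsection \<open>Transitive tournaments\<close>

lemma chain_cong:
  assumes bij: "bij_betw \<pi> {..n} {..n}" and eq: "\<And>k. k \<le> n \<Longrightarrow> \<pi> k = \<pi>' k"
  shows "chain n a \<pi> = chain n a \<pi>'"
proof (rule PiE_ext[OF chain_in_PiE[OF bij] chain_in_PiE])
  show bij': "bij_betw \<pi>' {..n} {..n}" using bij_betw_cong[of "{..n}" \<pi> \<pi>' "{..n}"] bij eq by simp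
  fix i assume "i \<in> {..n}"
  then obtain k where k: "k \<le> n" "i = \<pi> k"
    using bij by (metis atMost_iff bij_betw_iff_bijections)
  have "chain n a \<pi> (\<pi> k) = (\<Sum>l<k. a (\<pi> l))" by (rule chain_apply[OF bij k(1)])
  also have "\<dots> = (\<Sum>l<k. a (\<pi>' l))" using k eq by (intro sum.cong) auto
  also have "\<dots> = chain n a \<pi>' (\<pi>' k)" by (rule chain_apply[OF bij' k(1), symmetric])
  finally show "chain n a \<pi> i = chain n a \<pi>' i" using k eq[OF k(1)] by simp
qed

text \<open>Up to the factor q ^ (- c k), the numerator for k is the difference of the powers of q
  at \<open>P (Suc k)\<close> and \<open>P (Suc l)\<close>, that is, the denominator for k + 1. The
  row telescopes, leaving its last numerator over its first denominator.\<close>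

lemma telescoping_row:
  fixes c :: "nat \<Rightarrow> nat" and l :: nat
  assumes "0 < c l"
  defines "P \<equiv> \<lambda>k. \<Sum>t<k. c t"
  shows "(\<Prod>k<l. qK ^ P k - qK ^ (P (Suc l) - c k)) / (\<Prod>k<l. qK ^ P k - qK ^ P (Suc l))
    = (1 - qK ^ c l) / (1 - qK ^ P (Suc l))"
proof -
  have le: "P k + c k \<le> P (Suc l)" if "k \<le> l" for k
    using sum_lessThan_plus_le[of k "Suc l" c] that by (simp add: P_def)
  have "P k < P (Suc l)" if "k \<le> l" for k
    using assms(1) sum_mono2[of "{..<l}" "{..<k}" c] that by (fastforce simp: P_def)
  then have nz: "qK ^ P k - qK ^ P (Suc l) \<noteq> 0" if "k \<le> l" for k
    using that by fastforce
  have tele: "(\<Prod>k<j. qK ^ P k - qK ^ (P (Suc l) - c k)) * (qK ^ P j * (1 - qK ^ P (Suc l)))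
     = (\<Prod>k<j. qK ^ P k - qK ^ P (Suc l)) * (qK ^ P j - qK ^ P (Suc l))" if "j \<le> l" for j
    using that
  proof (induction j)
    case 0
    then show ?case by (simp add: P_def)
  next
    case (Suc j)
    have Pj: "P (Suc j) = P j + c j" by (simp add: P_def)
    obtain d where d: "P (Suc l) = c j + d" using le[of j] Suc.prems by (metis le_add2 le_iff_add le_trans Suc_leD)
    have "(\<Prod>k<Suc j. qK ^ P k - qK ^ (P (Suc l) - c k)) * (qK ^ P (Suc j) * (1 - qK ^ P (Suc l)))
      = ((\<Prod>k<j. qK ^ P k - qK ^ (P (Suc l) - c k)) * (qK ^ P j * (1 - qK ^ P (Suc l))))
        * ((qK ^ P j - qK ^ (P (Suc l) - c j)) * qK ^ c j)"
      unfolding Pj by (simp add: power_add mult_ac)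
    also have "(qK ^ P j - qK ^ (P (Suc l) - c j)) * qK ^ c j = qK ^ P (Suc j) - qK ^ P (Suc l)"
      unfolding Pj d by (simp add: power_add algebra_simps)
    also have "(\<Prod>k<j. qK ^ P k - qK ^ (P (Suc l) - c k)) * (qK ^ P j * (1 - qK ^ P (Suc l)))
      = (\<Prod>k<j. qK ^ P k - qK ^ P (Suc l)) * (qK ^ P j - qK ^ P (Suc l))"
      using Suc by simp
    finally show ?case by simp
  qed
  have "qK ^ P l - qK ^ P (Suc l) = qK ^ P l * (1 - qK ^ c l)"
    by (simp add: P_def power_add algebra_simps)
  with tele[of l] have "(\<Prod>k<l. qK ^ P k - qK ^ (P (Suc l) - c k)) * (1 - qK ^ P (Suc l))
     = (\<Prod>k<l. qK ^ P k - qK ^ P (Suc l)) * (1 - qK ^ c l)"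
    by simp
  moreover have "1 - qK ^ P (Suc l) \<noteq> 0" using nz[of 0] by (simp add: P_def)
  moreover have "(\<Prod>k<l. qK ^ P k - qK ^ P (Suc l)) \<noteq> 0" using nz by auto
  ultimately show ?thesis by (simp add: divide_simps mult_ac)
qed

text \<open>The roots belong to the index at place k, one for each later place l > m, whereas the
  telescoping needs them collected by l.\<close>

lemma prod_triangle_max:
  fixes g :: "nat \<Rightarrow> nat \<Rightarrow> 'a :: comm_monoid_mult"
  shows "(\<Prod>k\<le>n. \<Prod>l\<in>{max k m<..n}. g k l) = (\<Prod>l\<in>{m<..n}. \<Prod>k<l. g k l)"
proof -
  have "(\<Prod>z\<in>Sigma {..n} (\<lambda>k. {max k m<..n}). g (fst z) (snd z))
    = (\<Prod>z\<in>Sigma {m<..n} (\<lambda>l. {..<l}). g (snd z) (fst z))"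
    by (intro prod.reindex_bij_witness[of _ prod.swap prod.swap]) auto
  then show ?thesis by (simp add: prod.Sigma case_prod_unfold)
qed

text \<open>W, X, Y, Z stand for q to the parameters of 0, 1, 2, \<open>\<sigma> 3\<close>. The left
  side is the four-place part for the order 2, 0, 1, \<open>\<sigma> 3\<close>; exchanging Y and Z
  gives the other surviving order.\<close>

lemma survivor_value:
  fixes W X Y Z :: "'a :: field"
  assumes "W \<noteq> 0" "Y \<noteq> 0" "1 - W * Y \<noteq> 0" "1 - X * Z \<noteq> 0"
  shows "((Y - X * Y * Z) * (Y - X * Y) * (Y - X * Z) * (Y - 1)) * ((W * Y - W * Y * Z) * (W * Y - 1))
    / ((1 - W * Y) * (1 - W * X * Y) * (Y - W * X * Y)
       * ((1 - W * X * Y * Z) * (Y - W * X * Y * Z) * (W * Y - W * X * Y * Z)))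
   = (1 - X) * (Y - X * Z) * (1 - Y) * (1 - Z)
     / ((1 - W * X) * (1 - W * X * Y) * (1 - W * X * Z) * (1 - W * X * Y * Z))"
proof -
  \<comment> \<open>The common factor of numerator and denominator; the signs of Y - 1 and W * Y - 1
    compensate each other.\<close>
  define c where "c = W * Y * Y * Y * (1 - X * Z) * (1 - W * Y)"
  have c: "c \<noteq> 0" using assms by (simp add: c_def)
  have num: "((Y - X * Y * Z) * (Y - X * Y) * (Y - X * Z) * (Y - 1)) * ((W * Y - W * Y * Z) * (W * Y - 1))
    = c * ((1 - X) * (Y - X * Z) * (1 - Y) * (1 - Z))"
    by (simp add: c_def algebra_simps)
  have den: "(1 - W * Y) * (1 - W * X * Y) * (Y - W * X * Y)
       * ((1 - W * X * Y * Z) * (Y - W * X * Y * Z) * (W * Y - W * X * Y * Z))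
    = c * ((1 - W * X) * (1 - W * X * Y) * (1 - W * X * Z) * (1 - W * X * Y * Z))"
    by (simp add: c_def algebra_simps)
  show ?thesis unfolding num den by (rule mult_divide_mult_cancel_left[OF c])
qed

text \<open>The hypotheses are what the roots of \<open>extra\<close> exclude. Neither 0 nor 1 comes
  first and neither comes last; if 0 were third, the first two would be 1 with 2 or 3, which
  \<open>z0\<close> excludes, or 2 and 3, which puts 1 last.\<close>

lemma four_orders:
  fixes \<beta> :: "nat \<Rightarrow> nat" and x y z t :: nat
  assumes dom: "x \<le> 3" "y \<le> 3" "z \<le> 3" "t \<le> 3"
    and dist: "x \<noteq> y" "x \<noteq> z" "x \<noteq> t" "y \<noteq> z" "y \<noteq> t" "z \<noteq> t"
    and x: "x \<noteq> 0" "x \<noteq> 1"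
    and z0: "z = 0 \<Longrightarrow> \<beta> x + \<beta> y \<noteq> \<beta> 1 + \<beta> 2 \<and> \<beta> x + \<beta> y \<noteq> \<beta> 1 + \<beta> 3"
    and t0: "t = 0 \<Longrightarrow> \<beta> x + \<beta> y + \<beta> z \<noteq> \<beta> 1 + \<beta> 2 + \<beta> 3"
    and t1: "t = 1 \<Longrightarrow> \<beta> x + \<beta> y + \<beta> z \<noteq> \<beta> 0 + \<beta> 2 + \<beta> 3"
  shows "x = 2 \<and> y = 0 \<and> z = 1 \<and> t = 3 \<or> x = 3 \<and> y = 0 \<and> z = 1 \<and> t = 2"
proof -
  have "x = 2 \<or> x = 3" using dom x by linarith
  then show ?thesis
  proof
    assume x: "x = 2"
    then have "y = 0 \<or> y = 1 \<or> y = 3" "z = 0 \<or> z = 1 \<or> z = 3" "t = 0 \<or> t = 1 \<or> t = 3"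
      using dom dist by linarith+
    then have "y = 0 \<and> z = 1 \<and> t = 3 \<or> y = 0 \<and> z = 3 \<and> t = 1 \<or> y = 1 \<and> z = 0 \<and> t = 3
      \<or> y = 1 \<and> z = 3 \<and> t = 0 \<or> y = 3 \<and> z = 0 \<and> t = 1 \<or> y = 3 \<and> z = 1 \<and> t = 0"
      using dist by (elim disjE) simp_all
    then show ?thesis using z0 t0 t1 x by (elim disjE conjE) (simp_all add: add_ac)
  next
    assume x: "x = 3"
    then have "y = 0 \<or> y = 1 \<or> y = 2" "z = 0 \<or> z = 1 \<or> z = 2" "t = 0 \<or> t = 1 \<or> t = 2"
      using dom dist by linarith+
    then have "y = 0 \<and> z = 1 \<and> t = 2 \<or> y = 0 \<and> z = 2 \<and> t = 1 \<or> y = 1 \<and> z = 0 \<and> t = 2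
      \<or> y = 1 \<and> z = 2 \<and> t = 0 \<or> y = 2 \<and> z = 0 \<and> t = 1 \<or> y = 2 \<and> z = 1 \<and> t = 0"
      using dist by (elim disjE) simp_all
    then show ?thesis using z0 t0 t1 x by (elim disjE conjE) (simp_all add: add_ac)
  qed
qed

section \<open>The ranking and its auxiliary polynomials\<close>

locale dyson_transitive = dyson_tournament +
  fixes \<sigma> :: "nat \<Rightarrow> nat"
  assumes trans: "transitive_tourn n Q" and winner: "winner_perm n Q \<sigma>"
begin

lemma \<sigma>_bij: "bij_betw \<sigma> {1..n} {1..n}"
  using winner by (simp add: winner_perm_def)

lemma \<sigma>_range: "1 \<le> k \<Longrightarrow> k \<le> n \<Longrightarrow> 1 \<le> \<sigma> k" "1 \<le> k \<Longrightarrow> k \<le> n \<Longrightarrow> \<sigma> k \<le> n"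
  using bij_betw_apply[OF \<sigma>_bij, of k] by auto

lemma \<sigma>_eq_iff: "1 \<le> k \<Longrightarrow> k \<le> n \<Longrightarrow> 1 \<le> l \<Longrightarrow> l \<le> n \<Longrightarrow> \<sigma> k = \<sigma> l \<longleftrightarrow> k = l"
  using inj_on_eq_iff[OF bij_betw_imp_inj_on[OF \<sigma>_bij], of k l] by simp

text \<open>\<open>winner_perm\<close> speaks of consecutive entries only; the absence of 3-cycles
  extends it to all pairs.\<close>

lemma \<sigma>_beats:
  assumes "1 \<le> k" "k < l" "l \<le> n"
  shows "beats Q (\<sigma> k) (\<sigma> l)"
  using assms(2,3)
proof (induction l)
  case (Suc l)
  have step: "beats Q (\<sigma> l) (\<sigma> (Suc l))"
    using winner Suc.prems assms(1) by (simp add: winner_perm_def)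
  show ?case
  proof (cases "k = l")
    case True
    then show ?thesis using step by simp
  next
    case False
    then have kl: "k < l" using Suc.prems by simp
    then have IH: "beats Q (\<sigma> k) (\<sigma> l)" using Suc by simp
    have mem: "\<sigma> k \<in> {1..n}" "\<sigma> l \<in> {1..n}" "\<sigma> (Suc l) \<in> {1..n}"
      using \<sigma>_range Suc.prems assms(1) kl by simp_all
    have "\<not> beats Q (\<sigma> (Suc l)) (\<sigma> k)"
      using trans IH step mem unfolding transitive_tourn_def by blast
    moreover have "\<sigma> k \<noteq> \<sigma> (Suc l)" using \<sigma>_eq_iff[of k "Suc l"] Suc.prems assms(1) by simp
    ultimately show ?thesis using beats_total by blast
  qed
qed simp

lemma \<sigma>_1: "\<sigma> 1 = 1"
proof -
  obtain p where p: "p \<in> {1..n}" "\<sigma> p = 1"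
    using \<sigma>_bij n by (metis atLeastAtMost_iff bij_betw_iff_bijections le_trans one_le_numeral order_refl)
  have "\<not> 1 < p" using \<sigma>_beats[of 1 p] p not_beats_1[of "\<sigma> 1"] \<sigma>_range(1)[of 1] by auto
  then show ?thesis using p by auto
qed

text \<open>Only player 1 beats player 2, and player 1 already holds the first rank.\<close>

lemma \<sigma>_2: "\<sigma> 2 = 2"
proof -
  obtain p where p: "p \<in> {1..n}" "\<sigma> p = 2"
    using \<sigma>_bij n by (metis (no_types, opaque_lifting) Suc_1 Suc_leD atLeastAtMost_iff bij_betw_iff_bijections
        numeral_3_eq_3 one_le_numeral numeral_2_eq_2)
  have "\<not> 2 < p"
  proof
    assume "2 < p"
    then have "\<sigma> 2 = 1" using \<sigma>_beats[of 2 p] p beats_2D[of "\<sigma> 2"] \<sigma>_range(1)[of 2] by auto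
    then show False using \<sigma>_1 \<sigma>_eq_iff[of 1 2] n by simp
  qed
  moreover have "p \<noteq> 1" using p \<sigma>_1 by auto
  ultimately have "p = 2" using p by auto
  then show ?thesis using p by simp
qed

lemma \<sigma>_ge_3: "3 \<le> k \<Longrightarrow> k \<le> n \<Longrightarrow> 3 \<le> \<sigma> k"
  using \<sigma>_range(1)[of k] \<sigma>_eq_iff[of k 1] \<sigma>_eq_iff[of k 2] \<sigma>_1 \<sigma>_2 by linarith

text \<open>The ranking extended by the index 0 in front. Orders are described relative to it, and
  \<open>b\<close> lists the parameters by rank.\<close>

definition \<rho> :: "nat \<Rightarrow> nat" where "\<rho> k = (if k = 0 then 0 else \<sigma> k)"

definition b :: "nat \<Rightarrow> nat" where "b k = a (\<rho> k)"

lemma \<rho>_simps [simp]: "\<rho> 0 = 0" "\<rho> (Suc 0) = 1" "\<rho> 2 = 2"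
  using \<sigma>_1 \<sigma>_2 by (simp_all add: \<rho>_def)

lemma \<rho>_bij: "bij_betw \<rho> {..n} {..n}"
proof -
  have "bij_betw \<rho> ({0} \<union> {1..n}) ({0} \<union> {1..n})"
  proof (rule bij_betw_combine)
    have "bij_betw \<rho> {1..n} {1..n} \<longleftrightarrow> bij_betw \<sigma> {1..n} {1..n}"
      by (rule bij_betw_cong) (simp add: \<rho>_def)
    then show "bij_betw \<rho> {1..n} {1..n}" using \<sigma>_bij by simp
  qed (auto simp: bij_betw_def)
  moreover have "{0} \<union> {1..n} = {..n}" by auto
  ultimately show ?thesis by simp
qed

lemma \<rho>_eq_iff: "k \<le> n \<Longrightarrow> l \<le> n \<Longrightarrow> \<rho> k = \<rho> l \<longleftrightarrow> k = l"
  using inj_on_eq_iff[OF bij_betw_imp_inj_on[OF \<rho>_bij], of k l] by simp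

lemma \<rho>_surj: assumes "i \<le> n" obtains p where "p \<le> n" "i = \<rho> p"
  using \<rho>_bij assms by (metis atMost_iff bij_betw_iff_bijections)

lemma b_pos: "1 \<le> k \<Longrightarrow> k \<le> n \<Longrightarrow> 1 \<le> b k"
  using pos \<sigma>_range by (simp add: b_def \<rho>_def)

lemma sum_b: "(\<Sum>k\<le>n. b k) = N"
  using sum_perm_atMost[OF \<rho>_bij, of a] by (simp add: N_def b_def)

lemma w_\<rho>: assumes "3 \<le> p" "p \<le> n" shows "w (\<rho> p) = n - p"
proof -
  have "{j\<in>{1..n}. beats Q (\<rho> p) j} = \<sigma> ` {p<..n}"
  proof (intro equalityI subsetI)
    fix j assume "j \<in> {j\<in>{1..n}. beats Q (\<rho> p) j}"
    then have j: "j \<in> {1..n}" "beats Q (\<sigma> p) j" using assms by (auto simp: \<rho>_def)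
    then obtain l where l: "l \<in> {1..n}" "j = \<sigma> l" using \<sigma>_bij by (metis bij_betw_iff_bijections)
    have "\<not> l < p" using \<sigma>_beats[of l p] beats_asym j l assms by auto
    moreover have "l \<noteq> p" using j l beats_irrefl by auto
    ultimately show "j \<in> \<sigma> ` {p<..n}" using l by auto
  next
    fix j assume "j \<in> \<sigma> ` {p<..n}"
    then show "j \<in> {j\<in>{1..n}. beats Q (\<rho> p) j}"
      using \<sigma>_beats[of p] \<sigma>_range assms by (auto simp: \<rho>_def)
  qed
  moreover have "card (\<sigma> ` {p<..n}) = n - p"
    using \<sigma>_bij by (subst card_image) (auto simp: bij_betw_def intro: inj_on_subset)
  ultimately show ?thesis
    using \<sigma>_ge_3[OF assms] assms by (simp add: w_def \<rho>_def)
qed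

text \<open>An index of rank p > 3 is banned from the last n - p places, those of rank at most 3
  from the last n - 3.\<close>

definition r :: "nat \<Rightarrow> nat" where "r i = n - max (inv_into {..n} \<rho> i) 3"

lemma r_\<rho>: "p \<le> n \<Longrightarrow> r (\<rho> p) = n - max p 3"
  using \<rho>_bij by (simp add: r_def bij_betw_def inv_into_f_f)

text \<open>The roots not forced by \<open>\<sigma> 4, \<dots>, \<sigma> n\<close> are chosen so that \<open>0\<close>, \<open>1\<close>, \<open>2\<close>, \<open>\<sigma> 3\<close> can start a chain in two
  orders only, namely \<open>2, 0, 1, \<sigma> 3\<close> and \<open>\<sigma> 3, 0, 1, 2\<close>.\<close>

definition extra :: "nat \<Rightarrow> K poly" where
  "extra i = (if i = 0 then \<Prod>s\<leftarrow>[b 1 + b 2 + b 3, b 1 + b 2, b 1 + b 3, 0]. [:- (qK ^ s), 1:]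
    else if i = 1 then \<Prod>s\<leftarrow>[b 0 + b 2 + b 3, 0]. [:- (qK ^ s), 1:] else 1)"

definition \<psi> :: "nat \<Rightarrow> K poly" where
  "\<psi> i = (\<Prod>t<r i. [:- (qK ^ (N - a i - (\<Sum>u<t. a (\<sigma> (n - u))))), 1:]) * extra i"

lemma extra_monic:
  "lead_coeff (extra i) = 1" "degree (extra i) = (if i = 0 then 4 else if i = 1 then 2 else 0)"
proof -
  have lc: "lead_coeff (\<Prod>s\<leftarrow>xs. [:- (qK ^ s), 1:]) = 1" for xs
  proof (induction xs)
    case (Cons s xs)
    have "lead_coeff (\<Prod>s\<leftarrow>s # xs. [:- (qK ^ s), 1:]) = lead_coeff [:- (qK ^ s), 1:] * lead_coeff (\<Prod>s\<leftarrow>xs. [:- (qK ^ s), 1:])"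
      by (simp only: list.map prod_list.Cons lead_coeff_mult)
    then show ?case using Cons by simp
  qed simp
  have deg: "degree (\<Prod>s\<leftarrow>xs. [:- (qK ^ s), 1:]) = length xs" for xs
  proof (induction xs)
    case (Cons s xs)
    have "(\<Prod>s\<leftarrow>xs. [:- (qK ^ s), 1:]) \<noteq> 0" using lc[of xs] by auto
    then show ?case using Cons by (simp only: list.map prod_list.Cons) (subst degree_mult_eq, auto)
  qed simp
  show "lead_coeff (extra i) = 1" unfolding extra_def using lc by auto
  show "degree (extra i) = (if i = 0 then 4 else if i = 1 then 2 else 0)"
    unfolding extra_def using deg by auto
qed

lemma poly_extra:
  "poly (extra 0) x = (x - qK ^ (b 1 + b 2 + b 3)) * (x - qK ^ (b 1 + b 2)) * (x - qK ^ (b 1 + b 3)) * (x - 1)"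
  "poly (extra 1) x = (x - qK ^ (b 0 + b 2 + b 3)) * (x - 1)"
  by (simp_all add: extra_def mult.assoc del: mult_pCons_left mult_pCons_right)

text \<open>The degree count: n - 3 forced roots plus 4, 2, 0, 0 for the ranks 0 to 3, and n - p
  roots for rank p > 3, the score of that player.\<close>

lemma \<psi>_monic:
  assumes "i \<le> n" shows "lead_coeff (\<psi> i) = 1" "degree (\<psi> i) = w i"
proof -
  show "lead_coeff (\<psi> i) = 1"
    unfolding \<psi>_def lead_coeff_mult prod_linear_factors(1)[OF finite_lessThan] extra_monic(1)
    by (rule mult_1)
  obtain p where p: "p \<le> n" "i = \<rho> p" using \<rho>_surj[OF assms] .
  have "degree (\<psi> i) = r i + degree (extra i)"
    unfolding \<psi>_def using extra_monic(1)[of i]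
    by (subst degree_mult_eq) (auto simp: prod_linear_factors)
  also have "\<dots> = w i"
  proof (cases "3 \<le> p")
    case True
    then show ?thesis
      using p r_\<rho>[of p] w_\<rho>[of p] \<sigma>_ge_3[of p] extra_monic(2)[of i] by (simp add: \<rho>_def max_def)
  next
    case False
    then consider "p = 0" | "p = 1" | "p = 2" by linarith
    then show ?thesis
      using n p r_\<rho>[of p] extra_monic(2)[of i] by cases (auto simp: w_def)
  qed
  finally show "degree (\<psi> i) = w i" .
qed

lemma surviving_order:
  assumes bij: "bij_betw \<pi> {..n} {..n}"
    and nz: "\<And>k. k \<le> n \<Longrightarrow> poly (\<psi> (\<pi> k)) (qK ^ chain n a \<pi> (\<pi> k)) \<noteq> 0"
  obtains p where "\<And>k. k \<le> n \<Longrightarrow> \<pi> k = \<rho> (p k)" "\<And>k. 3 < k \<Longrightarrow> p k = k"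
    "p 0 = 2 \<and> p 1 = 0 \<and> p 2 = 1 \<and> p 3 = 3 \<or> p 0 = 3 \<and> p 1 = 0 \<and> p 2 = 1 \<and> p 3 = 2"
proof -
  have root: "poly (\<psi> i) (qK ^ ((\<Sum>i\<le>n. a i) - a i - (\<Sum>u<t. a (\<sigma> (n - u))))) = 0" if "t < r i" for i t
    using that by (auto simp: \<psi>_def poly_prod N_def intro!: bexI[of _ t])
  have rs: "r (\<sigma> (n - u)) = u" if "u < n - 3" for u
  proof -
    have "\<rho> (n - u) = \<sigma> (n - u)" using that by (simp add: \<rho>_def)
    then show ?thesis using r_\<rho>[of "n - u"] that by (simp add: max_def)
  qed
  have ro: "n - 3 \<le> r i" if i: "i \<le> n" "i \<notin> (\<lambda>u. \<sigma> (n - u)) ` {..<n - 3}" for i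
  proof -
    obtain q where q: "q \<le> n" "i = \<rho> q" using \<rho>_surj[OF i(1)] .
    have "q \<le> 3"
    proof (rule ccontr)
      assume "\<not> q \<le> 3"
      then have "i = \<sigma> (n - (n - q))" "n - q < n - 3" using q by (auto simp: \<rho>_def)
      then show False using i by blast
    qed
    then show ?thesis using r_\<rho>[of q] q by (simp add: max_def)
  qed
  have tail0: "\<pi> (n - t) = \<sigma> (n - t)" if "t < n - 3" for t
    using chain_tail_forced(1)[of \<pi> n r \<psi> a "\<lambda>u. \<sigma> (n - u)" "n - 3" t] bij root nz rs ro that by simp
  have tail: "\<pi> k = \<rho> k" if "3 < k" "k \<le> n" for k
    using tail0[of "n - k"] that by (simp add: \<rho>_def)
  \<comment> \<open>The order expressed in ranks; beyond n it is the identity, so that it can be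
    compared with a fixed permutation on all of \<open>nat\<close>.\<close>
  define p where "p k = (if k \<le> n then inv_into {..n} \<rho> (\<pi> k) else k)" for k
  have \<pi>n: "\<pi> k \<le> n" if "k \<le> n" for k using bij that by (auto simp: bij_betw_def)
  have p: "\<pi> k = \<rho> (p k)" "p k \<le> n" if "k \<le> n" for k
    using \<pi>n[OF that] \<rho>_bij that inv_into_into[of "\<pi> k" \<rho> "{..n}"] f_inv_into_f[of "\<pi> k" \<rho> "{..n}"]
    by (auto simp: p_def bij_betw_def)
  have p_tail: "p k = k" if "3 < k" for k
    using p[of k] tail[OF that] \<rho>_eq_iff[of "p k" k] that by (cases "k \<le> n") (auto simp: p_def)
  have p_inj: "p k \<noteq> p l" if "k \<le> n" "l \<le> n" "k \<noteq> l" for k l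
    using p[OF that(1)] p[OF that(2)] inj_on_eq_iff[OF bij_betw_imp_inj_on[OF bij], of k l] that by auto
  have p3: "p k \<le> 3" if "k \<le> 3" for k
  proof (rule ccontr)
    assume "\<not> p k \<le> 3"
    then show False using p_tail[of "p k"] p_inj[of "p k" k] p[of k] that n by auto
  qed
  have P: "chain n a \<pi> (\<pi> k) = (\<Sum>t<k. b (p t))" if "k \<le> n" for k
    using chain_apply[OF bij that, of a] p(1) that by (simp add: b_def)
  have nz': "poly (extra (\<rho> (p k))) (qK ^ (\<Sum>t<k. b (p t))) \<noteq> 0" if "k \<le> n" for k
    using nz[OF that] P[OF that] p[OF that] by (auto simp: \<psi>_def)
  \<comment> \<open>The left end of index 0 must avoid the four roots of
    \<open>extra 0\<close>.\<close>
  have z0: "(\<Sum>t<k. b (p t)) \<notin> {0, b 1 + b 2, b 1 + b 3, b 1 + b 2 + b 3}" if "k \<le> n" "p k = 0" for k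
    using nz'[OF that(1)] unfolding that(2) \<rho>_simps poly_extra by auto
  have z1: "(\<Sum>t<k. b (p t)) \<notin> {0, b 0 + b 2 + b 3}" if "k \<le> n" "p k = 1" for k
    using nz'[OF that(1)] unfolding that(2) One_nat_def \<rho>_simps
    unfolding One_nat_def[symmetric] poly_extra by auto
  have s: "(\<Sum>t<1. b (p t)) = b (p 0)" "(\<Sum>t<2. b (p t)) = b (p 0) + b (p 1)"
    "(\<Sum>t<3. b (p t)) = b (p 0) + b (p 1) + b (p 2)"
    by (simp_all add: eval_nat_numeral)
  have n': "1 \<le> n" "2 \<le> n" using n by auto
  have "p 0 \<noteq> 0" "p 0 \<noteq> 1" using z0[of 0] z1[of 0] by auto
  then have "p 0 = 2 \<and> p 1 = 0 \<and> p 2 = 1 \<and> p 3 = 3 \<or> p 0 = 3 \<and> p 1 = 0 \<and> p 2 = 1 \<and> p 3 = 2"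
    using z0[OF n'(2), unfolded s] z0[OF n, unfolded s] z1[OF n, unfolded s] n
    by (intro four_orders[where \<beta> = b] p3 p_inj) auto
  then show ?thesis using that[of p] p(1) p_tail by blast
qed

section \<open>The contributions of the surviving orders\<close>

text \<open>A player of better rank beats one of worse rank, so a pair of players is inverted in the
  ranking exactly if it lies in \<open>Q\<close>; index 0 is never inverted.\<close>

lemma inversion_sign: "(\<Prod>l\<le>n. \<Prod>k<l. if \<rho> k < \<rho> l then 1 else - 1) = (- 1 :: K) ^ card Q"
proof -
  define g :: "nat \<Rightarrow> nat \<Rightarrow> K" where "g i j = (if (i, j) \<in> Q then - 1 else 1)" for i j
  have "(\<Prod>j\<le>n. \<Prod>i<j. g i j) = (\<Prod>l\<le>n. \<Prod>k<l. if \<rho> k < \<rho> l then 1 else - 1)"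
    unfolding prod_pairs_perm[OF \<rho>_bij, of g]
  proof (intro prod.cong refl)
    fix l k assume "l \<in> {..n}" "k \<in> {..<l}"
    then have kl: "k < l" "l \<le> n" by auto
    show "(if \<rho> k < \<rho> l then g (\<rho> k) (\<rho> l) else g (\<rho> l) (\<rho> k)) = (if \<rho> k < \<rho> l then 1 else - 1)"
    proof (cases "k = 0")
      case True
      then show ?thesis using kl \<sigma>_range(1)[of l] QD[of 0 "\<rho> l"] by (auto simp: g_def \<rho>_def)
    next
      case False
      then have "beats Q (\<rho> k) (\<rho> l)" using \<sigma>_beats[of k l] kl by (simp add: \<rho>_def)
      then show ?thesis by (auto simp: g_def beats_def)
    qed
  qed
  moreover have "(\<Prod>j\<le>n. \<Prod>i<j. g i j) = (\<Prod>z\<in>Q. - 1)"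
  proof -
    have "(\<Prod>j\<le>n. \<Prod>i<j. g i j) = (\<Prod>z\<in>Sigma {..n} (\<lambda>j. {..<j}). g (snd z) (fst z))"
      by (simp add: prod.Sigma case_prod_unfold)
    also have "\<dots> = (\<Prod>z\<in>prod.swap ` Q. g (snd z) (fst z))"
      using QD by (intro prod.mono_neutral_right) (fastforce simp: g_def image_iff)+
    also have "\<dots> = (\<Prod>z\<in>Q. - 1)"
      by (subst prod.reindex) (auto simp: g_def)
    finally show ?thesis .
  qed
  ultimately show ?thesis by simp
qed

text \<open>An order differing from the ranking by a permutation \<open>\<tau>\<close> of the first
  four places: everything beyond these places is independent of \<open>\<tau>\<close>, so two such
  orders differ only in a sign and a four-place quotient.\<close>

lemma chain_value:
  fixes \<tau> :: "nat \<Rightarrow> nat"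
  assumes \<tau>: "bij_betw \<tau> {..3} {..3}" "\<And>k. 3 < k \<Longrightarrow> \<tau> k = k"
  defines "\<pi> \<equiv> \<rho> \<circ> \<tau>" and "P \<equiv> \<lambda>k. \<Sum>t<k. b (\<tau> t)"
  defines "\<alpha> \<equiv> chain n a \<pi>"
  shows "bij_betw \<pi> {..n} {..n}"
    and "k \<le> n \<Longrightarrow> \<alpha> (\<rho> (\<tau> k)) = P k"
    and "(\<Prod>j\<le>n. \<Prod>i<j. pair_factor a (\<lambda>i. qK ^ \<alpha> i) i j)
       / (\<Prod>i\<le>n. \<Prod>s\<in>{..N - a i} - {\<alpha> i}. qK ^ \<alpha> i - qK ^ s)
       * (\<Prod>i\<le>n. poly (\<psi> i) (qK ^ \<alpha> i))
    = (\<Prod>l\<le>3. \<Prod>k<l. if \<rho> (\<tau> k) < \<rho> (\<tau> l) then 1 else - 1) * (- 1) ^ card Q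
      * (qfac N / (\<Prod>i\<le>n. qfac (a i)))
      * (\<Prod>l\<in>{3<..n}. (1 - qK ^ b l) / (1 - qK ^ (\<Sum>t<Suc l. b t)))
      * ((\<Prod>k\<le>3. poly (extra (\<rho> (\<tau> k))) (qK ^ P k)) / (\<Prod>l\<le>3. \<Prod>k<l. qK ^ P k - qK ^ P (Suc l)))"
proof -
  have \<tau>_bij: "bij_betw \<tau> {..<l} {..<l}" if "3 < l" for l
  proof -
    have "bij_betw \<tau> ({..3} \<union> {3<..<l}) ({..3} \<union> {3<..<l})"
    proof (rule bij_betw_combine[OF \<tau>(1)])
      have "bij_betw \<tau> {3<..<l} {3<..<l} \<longleftrightarrow> bij_betw (\<lambda>k. k) {3<..<l} {3<..<l}"
        by (rule bij_betw_cong) (use \<tau>(2) in auto)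
      then show "bij_betw \<tau> {3<..<l} {3<..<l}" by (simp add: bij_betw_def)
    qed auto
    moreover have "{..3} \<union> {3<..<l} = {..<l}" using that by auto
    ultimately show ?thesis by simp
  qed
  have \<tau>n: "bij_betw \<tau> {..n} {..n}" using \<tau>_bij[of "Suc n"] n by (simp add: lessThan_Suc_atMost)
  show bij: "bij_betw \<pi> {..n} {..n}"
    unfolding \<pi>_def by (rule bij_betw_trans[OF \<tau>n \<rho>_bij])
  have c: "a (\<pi> k) = b (\<tau> k)" for k by (simp add: \<pi>_def b_def)
  have \<alpha>: "\<alpha> (\<rho> (\<tau> k)) = P k" if "k \<le> n" for k
    using chain_apply[OF bij that, of a] c by (simp add: \<alpha>_def P_def \<pi>_def)
  then show "k \<le> n \<Longrightarrow> \<alpha> (\<rho> (\<tau> k)) = P k" .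
  have split: "(\<Prod>l\<le>n. f l) = (\<Prod>l\<le>3. f l) * (\<Prod>l\<in>{3<..n}. f l)" for f :: "nat \<Rightarrow> K"
  proof -
    have "{..n} = {..3} \<union> {3<..n}" using n by auto
    moreover have "prod f ({..3} \<union> {3<..n}) = prod f {..3} * prod f {3<..n}"
      by (rule prod.union_disjoint) auto
    ultimately show ?thesis by simp
  qed
  have P_tail: "P l = (\<Sum>t<l. b t)" if "3 < l" for l
    unfolding P_def by (rule sum.reindex_bij_betw[OF \<tau>_bij[OF that]])
  have PN: "P (Suc n) = N"
    using P_tail[of "Suc n"] n sum_b by (simp add: lessThan_Suc_atMost)

  have sign: "(\<Prod>l\<le>n. \<Prod>k<l. if \<pi> k < \<pi> l then 1 else - 1 :: K)
    = (\<Prod>l\<le>3. \<Prod>k<l. if \<rho> (\<tau> k) < \<rho> (\<tau> l) then 1 else - 1) * (- 1) ^ card Q"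
  proof -
    \<comment> \<open>For l > 3 the product runs over all earlier places, which
      \<open>\<tau>\<close> merely permutes.\<close>
    have tail: "(\<Prod>l\<in>{3<..n}. \<Prod>k<l. if \<pi> k < \<pi> l then 1 else - 1 :: K)
      = (\<Prod>l\<in>{3<..n}. \<Prod>k<l. if \<rho> k < \<rho> l then 1 else - 1)"
    proof (rule prod.cong[OF refl])
      fix l assume l: "l \<in> {3<..n}"
      have "(\<Prod>k<l. if \<rho> (\<tau> k) < \<rho> l then 1 else - 1 :: K) = (\<Prod>k<l. if \<rho> k < \<rho> l then 1 else - 1)"
        using l by (intro prod.reindex_bij_betw[OF \<tau>_bij]) auto
      then show "(\<Prod>k<l. if \<pi> k < \<pi> l then 1 else - 1 :: K) = (\<Prod>k<l. if \<rho> k < \<rho> l then 1 else - 1)"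
        using l \<tau>(2)[of l] by (simp add: \<pi>_def)
    qed
    have head: "(\<Prod>l\<le>3. \<Prod>k<l. if \<rho> k < \<rho> l then 1 else - 1 :: K) = 1"
    proof -
      have "\<rho> k < \<rho> l" if "k < l" "l \<le> 3" for k l
      proof -
        have "3 \<le> \<rho> 3" using \<sigma>_ge_3[of 3] n by (simp add: \<rho>_def)
        moreover have "l = 1 \<and> k = 0 \<or> l = 2 \<and> k = 0 \<or> l = 2 \<and> k = 1
          \<or> l = 3 \<and> k = 0 \<or> l = 3 \<and> k = 1 \<or> l = 3 \<and> k = 2"
          using that by presburger
        ultimately show ?thesis by (elim disjE conjE) simp_all
      qed
      then show ?thesis by (intro prod.neutral ballI) auto
    qed
    show ?thesis
      unfolding inversion_sign[symmetric] split tail head mult_1 by (simp only: \<pi>_def comp_apply)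
  qed

  \<comment> \<open>Removing the last t lengths leaves the right end of the interval at place n - t,
    so each forced root is attached to a place l = n - t.\<close>
  have tail_sum: "N - (\<Sum>u<t. a (\<sigma> (n - u))) = P (Suc (n - t))" if "t < n - 3" for t
  proof -
    have "(\<Sum>u<t. a (\<sigma> (n - u))) = (\<Sum>u<t. b (\<tau> (n - u)))"
      using that \<tau>(2) by (intro sum.cong) (auto simp: b_def \<rho>_def)
    also have "\<dots> = (\<Sum>l\<in>{n - t<..n}. b (\<tau> l))"
      using that by (intro sum.reindex_bij_witness[of _ "\<lambda>l. n - l" "\<lambda>u. n - u"]) auto
    finally show ?thesis
      using sum_atMost_split_at[of "n - t" n "\<lambda>l. b (\<tau> l)"] PN[unfolded P_def lessThan_Suc_atMost]
      by (simp add: P_def)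
  qed
  have psi: "poly (\<psi> (\<pi> k)) (qK ^ P k)
     = (\<Prod>l\<in>{max k 3<..n}. qK ^ P k - qK ^ (P (Suc l) - b (\<tau> k))) * poly (extra (\<pi> k)) (qK ^ P k)"
    if k: "k \<le> n" for k
  proof -
    have "max (\<tau> k) 3 = max k 3"
      using \<tau>(2)[of k] bij_betw_apply[OF \<tau>(1), of k] by (cases "3 < k") auto
    then have r: "r (\<pi> k) = n - max k 3"
      using r_\<rho>[of "\<tau> k"] bij_betw_apply[OF \<tau>n, of k] k by (simp add: \<pi>_def)
    have "(\<Prod>t<r (\<pi> k). qK ^ P k - qK ^ (N - a (\<pi> k) - (\<Sum>u<t. a (\<sigma> (n - u)))))
      = (\<Prod>t<n - max k 3. qK ^ P k - qK ^ (P (Suc (n - t)) - b (\<tau> k)))"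
      unfolding r
    proof (intro prod.cong refl)
      fix t assume "t \<in> {..<n - max k 3}"
      then have "N - (\<Sum>u<t. a (\<sigma> (n - u))) = P (Suc (n - t))" by (intro tail_sum) auto
      then show "qK ^ P k - qK ^ (N - a (\<pi> k) - (\<Sum>u<t. a (\<sigma> (n - u))))
        = qK ^ P k - qK ^ (P (Suc (n - t)) - b (\<tau> k))"
        using diff_commute[of N "a (\<pi> k)"] by (simp add: c)
    qed
    also have "\<dots> = (\<Prod>l\<in>{max k 3<..n}. qK ^ P k - qK ^ (P (Suc l) - b (\<tau> k)))"
      by (intro prod.reindex_bij_witness[of _ "\<lambda>l. n - l" "\<lambda>u. n - u"]) auto
    finally show ?thesis by (simp add: \<psi>_def poly_prod)
  qed
  have "(\<Prod>i\<le>n. poly (\<psi> i) (qK ^ \<alpha> i)) = (\<Prod>k\<le>n. poly (\<psi> (\<pi> k)) (qK ^ \<alpha> (\<pi> k)))"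
    by (rule prod.reindex_bij_betw[OF bij, symmetric])
  also have "\<dots> = (\<Prod>k\<le>n. poly (\<psi> (\<pi> k)) (qK ^ P k))"
    using \<alpha> by (intro prod.cong) (auto simp: \<pi>_def)
  also have "\<dots> = (\<Prod>l\<in>{3<..n}. \<Prod>k<l. qK ^ P k - qK ^ (P (Suc l) - b (\<tau> k)))
      * (\<Prod>k\<le>n. poly (extra (\<pi> k)) (qK ^ P k))"
    unfolding prod_triangle_max[symmetric] prod.distrib[symmetric] using psi by (intro prod.cong) auto
  also have "(\<Prod>k\<le>n. poly (extra (\<pi> k)) (qK ^ P k)) = (\<Prod>k\<le>3. poly (extra (\<rho> (\<tau> k))) (qK ^ P k))"
  proof -
    have "poly (extra (\<pi> k)) (qK ^ P k) = 1" if "k \<in> {3<..n}" for k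
      using that \<tau>(2)[of k] \<sigma>_ge_3[of k] by (simp add: \<pi>_def extra_def \<rho>_def)
    then show ?thesis unfolding split by (simp add: \<pi>_def)
  qed
  finally have psis: "(\<Prod>i\<le>n. poly (\<psi> i) (qK ^ \<alpha> i))
    = (\<Prod>l\<in>{3<..n}. \<Prod>k<l. qK ^ P k - qK ^ (P (Suc l) - b (\<tau> k)))
      * (\<Prod>k\<le>3. poly (extra (\<rho> (\<tau> k))) (qK ^ P k))" .

  \<comment> \<open>The forced roots meet the divisors of \<open>chain_term\<close> row by row, and
    each row beyond place 3 telescopes to a factor of the final product.\<close>
  have rows: "(\<Prod>l\<in>{3<..n}. \<Prod>k<l. qK ^ P k - qK ^ (P (Suc l) - b (\<tau> k)))
      / (\<Prod>l\<in>{3<..n}. \<Prod>k<l. qK ^ P k - qK ^ P (Suc l))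
    = (\<Prod>l\<in>{3<..n}. (1 - qK ^ b l) / (1 - qK ^ (\<Sum>t<Suc l. b t)))"
  proof (subst prod_dividef[symmetric], rule prod.cong[OF refl])
    fix l assume l: "l \<in> {3<..n}"
    then have "0 < b (\<tau> l)" using b_pos[of l] \<tau>(2)[of l] by simp
    from telescoping_row[of "\<lambda>k. b (\<tau> k)", OF this]
    show "(\<Prod>k<l. qK ^ P k - qK ^ (P (Suc l) - b (\<tau> k))) / (\<Prod>k<l. qK ^ P k - qK ^ P (Suc l))
      = (1 - qK ^ b l) / (1 - qK ^ (\<Sum>t<Suc l. b t))"
      using P_tail[of "Suc l"] \<tau>(2)[of l] l by (simp add: P_def)
  qed
  have "(\<Prod>j\<le>n. \<Prod>i<j. pair_factor a (\<lambda>i. qK ^ \<alpha> i) i j)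
       / (\<Prod>i\<le>n. \<Prod>s\<in>{..N - a i} - {\<alpha> i}. qK ^ \<alpha> i - qK ^ s)
    = (\<Prod>l\<le>n. \<Prod>k<l. if \<pi> k < \<pi> l then 1 else - 1) * (qfac N / (\<Prod>i\<le>n. qfac (a i)))
      / (\<Prod>l\<le>n. \<Prod>k<l. qK ^ P k - qK ^ P (Suc l))"
    using chain_term[of n a \<pi>, OF pos bij] by (simp only: N_def \<alpha>_def P_def c)
  also have "(\<Prod>l\<le>n. \<Prod>k<l. qK ^ P k - qK ^ P (Suc l))
    = (\<Prod>l\<le>3. \<Prod>k<l. qK ^ P k - qK ^ P (Suc l)) * (\<Prod>l\<in>{3<..n}. \<Prod>k<l. qK ^ P k - qK ^ P (Suc l))"
    by (rule split)
  finally show "(\<Prod>j\<le>n. \<Prod>i<j. pair_factor a (\<lambda>i. qK ^ \<alpha> i) i j)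
       / (\<Prod>i\<le>n. \<Prod>s\<in>{..N - a i} - {\<alpha> i}. qK ^ \<alpha> i - qK ^ s)
       * (\<Prod>i\<le>n. poly (\<psi> i) (qK ^ \<alpha> i))
    = (\<Prod>l\<le>3. \<Prod>k<l. if \<rho> (\<tau> k) < \<rho> (\<tau> l) then 1 else - 1) * (- 1) ^ card Q
      * (qfac N / (\<Prod>i\<le>n. qfac (a i)))
      * (\<Prod>l\<in>{3<..n}. (1 - qK ^ b l) / (1 - qK ^ (\<Sum>t<Suc l. b t)))
      * ((\<Prod>k\<le>3. poly (extra (\<rho> (\<tau> k))) (qK ^ P k)) / (\<Prod>l\<le>3. \<Prod>k<l. qK ^ P k - qK ^ P (Suc l)))"
    unfolding psis sign rows[symmetric] by (simp only: times_divide_eq_left times_divide_eq_right divide_divide_eq_left mult_ac)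
qed

end

lemma prod_le_3:
  fixes f :: "nat \<Rightarrow> 'a :: comm_monoid_mult" and g :: "nat \<Rightarrow> nat \<Rightarrow> 'a"
  shows "(\<Prod>k\<le>3. f k) = f 0 * f 1 * f 2 * f 3"
    and "(\<Prod>l\<le>3. \<Prod>k<l. g k l) = g 0 1 * g 0 2 * g 1 2 * (g 0 3 * g 1 3 * g 2 3)"
  by (simp_all add: eval_nat_numeral mult.assoc)

context dyson_transitive
begin

lemma CT_transitive:
  "CT F = (- 1) ^ card Q
     * ((1 + qK ^ a (\<sigma> 1)) * (qK ^ a (\<sigma> 2) - qK ^ a (\<sigma> 3)) / (1 - qK ^ (a 0 + a (\<sigma> 1) + a (\<sigma> 3))))
     * (qfac (\<Sum>i\<le>n. a i) / (\<Prod>i\<le>n. qfac (a i)))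
     * (\<Prod>i=1..n. (1 - qK ^ a i) / (1 - qK ^ (a 0 + (\<Sum>k=1..i. a (\<sigma> k)))))"
proof -
  \<comment> \<open>The two permutations list the ranks in the surviving orders 2, 0, 1, 3 and 3, 0,
    1, 2.\<close>
  define \<tau>1 :: "nat \<Rightarrow> nat" where "\<tau>1 k = (if k = 0 then 2 else if k = 1 then 0 else if k = 2 then 1 else k)" for k
  define \<tau>2 :: "nat \<Rightarrow> nat"
    where "\<tau>2 k = (if k = 0 then 3 else if k = 1 then 0 else if k = 2 then 1 else if k = 3 then 2 else k)" for k
  define T where "T \<alpha> = (\<Prod>j\<le>n. \<Prod>i<j. pair_factor a (\<lambda>i. qK ^ \<alpha> i) i j)
       / (\<Prod>i\<le>n. \<Prod>s\<in>{..N - a i} - {\<alpha> i}. qK ^ \<alpha> i - qK ^ s)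
       * (\<Prod>i\<le>n. poly (\<psi> i) (qK ^ \<alpha> i))" for \<alpha>
  define C where "C = (- 1) ^ card Q * (qfac N / (\<Prod>i\<le>n. qfac (a i)))
      * (\<Prod>l\<in>{3<..n}. (1 - qK ^ b l) / (1 - qK ^ (\<Sum>t<Suc l. b t)))"
  define W X Y Z where "W = qK ^ b 0" and "X = qK ^ b 1" and "Y = qK ^ b 2" and "Z = qK ^ b 3"
  have at3: "{..3::nat} = {0, 1, 2, 3}" by auto
  have \<tau>1: "bij_betw \<tau>1 {..3} {..3}" "\<And>k. 3 < k \<Longrightarrow> \<tau>1 k = k"
    unfolding at3 by (auto simp: \<tau>1_def bij_betw_def inj_on_def)
  have \<tau>2: "bij_betw \<tau>2 {..3} {..3}" "\<And>k. 3 < k \<Longrightarrow> \<tau>2 k = k"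
    unfolding at3 by (auto simp: \<tau>2_def bij_betw_def inj_on_def)
  define \<alpha>1 \<alpha>2 where "\<alpha>1 = chain n a (\<rho> \<circ> \<tau>1)" and "\<alpha>2 = chain n a (\<rho> \<circ> \<tau>2)"
  have b_pos': "0 < b 1" "0 < b 2" "0 < b 3"
    using b_pos[of 1] b_pos[of 2] b_pos[of 3] n by auto
  have sums: "(\<Sum>t<1. f t) = f 0" "(\<Sum>t<2. f t) = f 0 + f 1" "(\<Sum>t<3. f t) = f 0 + f 1 + f 2"
    "(\<Sum>t<4. f t) = f 0 + f 1 + f 2 + f 3" for f :: "nat \<Rightarrow> nat"
    by (simp_all add: eval_nat_numeral)
  have \<tau>1_vals: "\<tau>1 0 = 2" "\<tau>1 1 = 0" "\<tau>1 2 = 1" "\<tau>1 3 = 3" by (simp_all add: \<tau>1_def)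
  have \<tau>2_vals: "\<tau>2 0 = 3" "\<tau>2 1 = 0" "\<tau>2 2 = 1" "\<tau>2 3 = 2" by (simp_all add: \<tau>2_def)
  have \<rho>3: "3 \<le> \<rho> 3" using \<sigma>_ge_3[of 3] n by (simp add: \<rho>_def)
  have ne: "\<alpha>1 \<noteq> \<alpha>2"
  \<comment> \<open>The player of rank 3 starts at 0 in the second order and strictly later in the
    first.\<close>
  proof
    assume eq: "\<alpha>1 = \<alpha>2"
    have "\<alpha>1 (\<rho> 3) = b 2 + b 0 + b 1"
      using chain_value(2)[OF \<tau>1 n, unfolded sums \<tau>1_vals] by (simp add: \<alpha>1_def)
    moreover have "\<alpha>2 (\<rho> 3) = 0"
      using chain_value(2)[OF \<tau>2, of 0, unfolded \<tau>2_vals] by (simp add: \<alpha>2_def)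
    ultimately show False using eq b_pos' by simp
  qed
  have zero: "T \<alpha> = 0" if \<alpha>: "\<alpha> \<in> PiE {..n} (\<lambda>i. {..N - a i})" "\<alpha> \<notin> {\<alpha>1, \<alpha>2}" for \<alpha>
  proof (rule ccontr)
    assume nz: "T \<alpha> \<noteq> 0"
    then have "(\<Prod>j\<le>n. \<Prod>i<j. pair_factor a (\<lambda>i. qK ^ \<alpha> i) i j) \<noteq> 0" by (auto simp: T_def)
    then obtain \<pi> where bij: "bij_betw \<pi> {..n} {..n}" and ch: "\<alpha> = chain n a \<pi>"
      using nonvanishing_node_is_chain[of n a \<alpha>] pos \<alpha> unfolding N_def by metis
    have nz': "poly (\<psi> (\<pi> k)) (qK ^ chain n a \<pi> (\<pi> k)) \<noteq> 0" if "k \<le> n" for k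
    proof -
      have "\<pi> k \<le> n" using that bij by (auto simp: bij_betw_def)
      then show ?thesis using nz by (auto simp: ch T_def)
    qed
    obtain p where p: "\<And>k. k \<le> n \<Longrightarrow> \<pi> k = \<rho> (p k)" "\<And>k. 3 < k \<Longrightarrow> p k = k"
      "p 0 = 2 \<and> p 1 = 0 \<and> p 2 = 1 \<and> p 3 = 3 \<or> p 0 = 3 \<and> p 1 = 0 \<and> p 2 = 1 \<and> p 3 = 2"
      using surviving_order[OF bij nz'] by metis
    have k: "k = 0 \<or> k = 1 \<or> k = 2 \<or> k = 3 \<or> 3 < k" for k :: nat by linarith
    have "p = \<tau>1 \<or> p = \<tau>2"
      using p(3)
    proof
      assume "p 0 = 2 \<and> p 1 = 0 \<and> p 2 = 1 \<and> p 3 = 3"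
      then have "p k = \<tau>1 k" for k using k[of k] p(2)[of k] by (auto simp: \<tau>1_def)
      then show ?thesis by blast
    next
      assume "p 0 = 3 \<and> p 1 = 0 \<and> p 2 = 1 \<and> p 3 = 2"
      then have "p k = \<tau>2 k" for k using k[of k] p(2)[of k] by (auto simp: \<tau>2_def)
      then show ?thesis by blast
    qed
    moreover have "\<alpha> = chain n a (\<rho> \<circ> p)"
      unfolding ch using p(1) by (intro chain_cong[OF bij]) simp
    ultimately show False using \<alpha>(2) by (auto simp: \<alpha>1_def \<alpha>2_def)
  qed
  have mem: "\<alpha>1 \<in> PiE {..n} (\<lambda>i. {..N - a i})" "\<alpha>2 \<in> PiE {..n} (\<lambda>i. {..N - a i})"
    unfolding \<alpha>1_def \<alpha>2_def N_def
    using chain_in_PiE[OF chain_value(1)[OF \<tau>1]] chain_in_PiE[OF chain_value(1)[OF \<tau>2]] by simp_all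
  have "CT F = (\<Sum>\<alpha>\<in>PiE {..n} (\<lambda>i. {..N - a i}). T \<alpha>)"
    unfolding T_def by (rule CT_node_sum[OF \<psi>_monic])
  also have "\<dots> = (\<Sum>\<alpha>\<in>{\<alpha>1, \<alpha>2}. T \<alpha>)"
    using mem zero by (intro sum.mono_neutral_right finite_PiE) auto
  also have "\<dots> = T \<alpha>1 + T \<alpha>2" using ne by simp
  finally have CT: "CT F = T \<alpha>1 + T \<alpha>2" .

  have nz: "W \<noteq> 0" "Y \<noteq> 0" "Z \<noteq> 0" "1 - W * Y \<noteq> 0" "1 - W * Z \<noteq> 0" "1 - X * Z \<noteq> 0" "1 - X * Y \<noteq> 0"
    using b_pos' by (auto simp: W_def X_def Y_def Z_def simp flip: power_add)
  have ex: "extra 2 = 1" "extra (\<rho> 3) = 1" using \<rho>3 by (auto simp: extra_def)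
  have sucs: "Suc 0 = 1" "Suc 1 = 2" "Suc 2 = 3" "Suc 3 = 4" by simp_all
  have \<rho>_vals: "\<rho> 0 = 0" "\<rho> 1 = 1" "\<rho> 2 = 2" by simp_all
  define P1 where "P1 k = (\<Sum>t<k. b (\<tau>1 t))" for k
  define P2 where "P2 k = (\<Sum>t<k. b (\<tau>2 t))" for k
  have P1: "qK ^ P1 0 = 1" "qK ^ P1 1 = Y" "qK ^ P1 2 = W * Y" "qK ^ P1 3 = W * X * Y" "qK ^ P1 4 = W * X * Y * Z"
    unfolding P1_def sums \<tau>1_vals by (simp_all add: power_add W_def X_def Y_def Z_def mult_ac)
  have P2: "qK ^ P2 0 = 1" "qK ^ P2 1 = Z" "qK ^ P2 2 = W * Z" "qK ^ P2 3 = W * X * Z" "qK ^ P2 4 = W * X * Z * Y"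
    unfolding P2_def sums \<tau>2_vals by (simp_all add: power_add W_def X_def Y_def Z_def mult_ac)
  have roots: "qK ^ (b 1 + b 2 + b 3) = X * Y * Z" "qK ^ (b 1 + b 2) = X * Y" "qK ^ (b 1 + b 3) = X * Z"
    "qK ^ (b 0 + b 2 + b 3) = W * Y * Z"
    by (simp_all add: power_add W_def X_def Y_def Z_def)

  \<comment> \<open>The order 2, 0, 1, \<open>\<sigma> 3\<close> has two inversions, the order
    \<open>\<sigma> 3\<close>, 0, 1, 2 has three; hence the difference below.\<close>
  have sign1: "(\<Prod>l\<le>3. \<Prod>k<l. if \<rho> (\<tau>1 k) < \<rho> (\<tau>1 l) then 1 else - 1 :: K) = 1"
    unfolding prod_le_3(2) \<tau>1_vals \<rho>_vals using \<rho>3 by simp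
  have sign2: "(\<Prod>l\<le>3. \<Prod>k<l. if \<rho> (\<tau>2 k) < \<rho> (\<tau>2 l) then 1 else - 1 :: K) = - 1"
    unfolding prod_le_3(2) \<tau>2_vals \<rho>_vals using \<rho>3 by simp
  have num1: "(\<Prod>k\<le>3. poly (extra (\<rho> (\<tau>1 k))) (qK ^ P1 k))
    = ((Y - X * Y * Z) * (Y - X * Y) * (Y - X * Z) * (Y - 1)) * ((W * Y - W * Y * Z) * (W * Y - 1))"
    unfolding prod_le_3(1) \<tau>1_vals \<rho>_vals ex poly_extra P1 roots by simp
  have num2: "(\<Prod>k\<le>3. poly (extra (\<rho> (\<tau>2 k))) (qK ^ P2 k))
    = ((Z - X * Z * Y) * (Z - X * Z) * (Z - X * Y) * (Z - 1)) * ((W * Z - W * Z * Y) * (W * Z - 1))"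
    unfolding prod_le_3(1) \<tau>2_vals \<rho>_vals ex poly_extra P2 roots by (simp add: mult_ac)
  have den1: "(\<Prod>l\<le>3. \<Prod>k<l. qK ^ P1 k - qK ^ P1 (Suc l))
    = (1 - W * Y) * (1 - W * X * Y) * (Y - W * X * Y)
       * ((1 - W * X * Y * Z) * (Y - W * X * Y * Z) * (W * Y - W * X * Y * Z))"
    unfolding prod_le_3(2) sucs P1 ..
  have den2: "(\<Prod>l\<le>3. \<Prod>k<l. qK ^ P2 k - qK ^ P2 (Suc l))
    = (1 - W * Z) * (1 - W * X * Z) * (Z - W * X * Z)
       * ((1 - W * X * Z * Y) * (Z - W * X * Z * Y) * (W * Z - W * X * Z * Y))"
    unfolding prod_le_3(2) sucs P2 ..
  have T1: "T \<alpha>1 = C * ((1 - X) * (Y - X * Z) * (1 - Y) * (1 - Z)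
     / ((1 - W * X) * (1 - W * X * Y) * (1 - W * X * Z) * (1 - W * X * Y * Z)))"
  proof -
    have "T \<alpha>1 = C * ((\<Prod>k\<le>3. poly (extra (\<rho> (\<tau>1 k))) (qK ^ P1 k)) / (\<Prod>l\<le>3. \<Prod>k<l. qK ^ P1 k - qK ^ P1 (Suc l)))"
      using chain_value(3)[OF \<tau>1] unfolding sign1
      by (simp only: T_def C_def \<alpha>1_def P1_def mult_1)
    then show ?thesis
      unfolding num1 den1 survivor_value[OF nz(1,2,4,6)] .
  qed
  have T2: "T \<alpha>2 = - C * ((1 - X) * (Z - X * Y) * (1 - Z) * (1 - Y)
     / ((1 - W * X) * (1 - W * X * Z) * (1 - W * X * Y) * (1 - W * X * Z * Y)))"
  proof -
    have "T \<alpha>2 = - C * ((\<Prod>k\<le>3. poly (extra (\<rho> (\<tau>2 k))) (qK ^ P2 k)) / (\<Prod>l\<le>3. \<Prod>k<l. qK ^ P2 k - qK ^ P2 (Suc l)))"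
      using chain_value(3)[OF \<tau>2] unfolding sign2
      by (simp only: T_def C_def \<alpha>2_def P2_def mult_minus_left mult_1)
    then show ?thesis
      unfolding num2 den2 survivor_value[OF nz(1,3,5,7)] .
  qed
  define D where "D = (1 - W * X) * (1 - W * X * Y) * (1 - W * X * Y * Z)"
  define G where "G = 1 - W * X * Z"
  have den: "(1 - W * X) * (1 - W * X * Y) * (1 - W * X * Z) * (1 - W * X * Y * Z) = D * G"
    "(1 - W * X) * (1 - W * X * Z) * (1 - W * X * Y) * (1 - W * X * Z * Y) = D * G"
    by (simp_all only: D_def G_def mult_ac)
  \<comment> \<open>The combination (Y - X Z) - (Z - X Y) = (1 + X) (Y - Z) produces the numerator
    of the result.\<close>
  have num: "(1 - X) * (Y - X * Z) * (1 - Y) * (1 - Z) - (1 - X) * (Z - X * Y) * (1 - Z) * (1 - Y)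
    = (1 + X) * (Y - Z) * ((1 - X) * (1 - Y) * (1 - Z))"
    by (simp add: algebra_simps)
  have "CT F = C * (((1 - X) * (Y - X * Z) * (1 - Y) * (1 - Z) - (1 - X) * (Z - X * Y) * (1 - Z) * (1 - Y)) / (D * G))"
    unfolding CT T1 T2 den diff_divide_distrib right_diff_distrib[of C] mult_minus_left by (rule add_uminus_conv_diff)
  also have "\<dots> = C * ((1 + X) * (Y - Z) / (1 - W * X * Z)) * ((1 - X) * (1 - Y) * (1 - Z) / D)"
    unfolding num G_def by (simp add: mult.commute[of D])
  also have "(1 - X) * (1 - Y) * (1 - Z) / D = (\<Prod>k\<in>{1..3}. (1 - qK ^ b k) / (1 - qK ^ (\<Sum>t<Suc k. b t)))"
  proof -
    have "{1..3::nat} = {1, 2, 3}" by auto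
    then show ?thesis
      by (simp add: D_def W_def X_def Y_def Z_def eval_nat_numeral power_add mult_ac)
  qed
  finally have "CT F = (- 1) ^ card Q * ((1 + X) * (Y - Z) / (1 - W * X * Z)) * (qfac N / (\<Prod>i\<le>n. qfac (a i)))
     * ((\<Prod>k\<in>{1..3}. (1 - qK ^ b k) / (1 - qK ^ (\<Sum>t<Suc k. b t)))
       * (\<Prod>l\<in>{3<..n}. (1 - qK ^ b l) / (1 - qK ^ (\<Sum>t<Suc l. b t))))"
    unfolding C_def by (simp only: mult_ac)
  also have "(\<Prod>k\<in>{1..3}. (1 - qK ^ b k) / (1 - qK ^ (\<Sum>t<Suc k. b t)))
       * (\<Prod>l\<in>{3<..n}. (1 - qK ^ b l) / (1 - qK ^ (\<Sum>t<Suc l. b t)))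
    = (\<Prod>k\<in>{1..3} \<union> {3<..n}. (1 - qK ^ b k) / (1 - qK ^ (\<Sum>t<Suc k. b t)))"
    by (rule prod.union_disjoint[symmetric]) auto
  also have "{1..3} \<union> {3<..n} = {1..n}" using n by auto
  also have "(\<Prod>k=1..n. (1 - qK ^ b k) / (1 - qK ^ (\<Sum>t<Suc k. b t)))
    = (\<Prod>i=1..n. (1 - qK ^ a i) / (1 - qK ^ (a 0 + (\<Sum>k=1..i. a (\<sigma> k)))))"
    unfolding prod_dividef
  proof (rule arg_cong2[of _ _ _ _ "(/)"])
    have "(\<Prod>k=1..n. 1 - qK ^ b k) = (\<Prod>k=1..n. 1 - qK ^ a (\<sigma> k))"
      by (intro prod.cong) (auto simp: b_def \<rho>_def)
    also have "\<dots> = (\<Prod>i=1..n. 1 - qK ^ a i)"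
      by (rule prod.reindex_bij_betw[OF \<sigma>_bij])
    finally show "(\<Prod>k=1..n. 1 - qK ^ b k) = (\<Prod>i=1..n. 1 - qK ^ a i)" .
    have "(\<Sum>t<Suc k. b t) = a 0 + (\<Sum>k=1..k. a (\<sigma> k))" for k
      by (induction k) (simp_all add: b_def \<rho>_def)
    then show "(\<Prod>k=1..n. 1 - qK ^ (\<Sum>t<Suc k. b t)) = (\<Prod>i=1..n. 1 - qK ^ (a 0 + (\<Sum>k=1..i. a (\<sigma> k))))"
      by (simp only:)
  qed
  finally show ?thesis
    by (simp add: X_def Y_def Z_def W_def N_def b_def \<rho>_def power_add mult_ac)
qed

end

section \<open>Vanishing parameters\<close>

text \<open>D_n contributes at most -k to the exponent of x_k, while the monomial contributes less
  than k, since at most the pairs (i, k) with 3 \<le> i < k raise it. The exponents cannot add up to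
  0.\<close>

lemma CT_zero_param:
  assumes Q: "Q \<subseteq> {(i, j). 3 \<le> i \<and> i < j \<and> j \<le> n}" and k: "1 \<le> k" "k \<le> n" and ak: "a k = 0"
    and pos: "\<And>j. k < j \<Longrightarrow> j \<le> n \<Longrightarrow> 1 \<le> a j"
  shows "CT (lmul (lmono (prefactor Q)) (Dn n a)) = 0"
proof (rule ccontr)
  assume "CT (lmul (lmono (prefactor Q)) (Dn n a)) \<noteq> 0"
  then have "(\<lambda>_. 0) \<in> lsupp (lmul (lmono (prefactor Q)) (Dn n a))"
    by (simp add: CT_def lsupp_def)
  then obtain d where d: "d \<in> lsupp (Dn n a)" "(\<lambda>_. 0) = (\<lambda>k. prefactor Q k + d k)"
    by (elim lsupp_lmulE) (auto simp: lsupp_lmono)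
  have "0 = prefactor Q k + d k" using fun_cong[OF d(2), of k] by simp
  with lsupp_Dn_zero_param[OF k ak pos d(1)] have "int k \<le> prefactor Q k" by simp
  moreover have "card {p\<in>Q. snd p = k} \<le> card {3..<k}"
    using Q by (intro card_inj_on_le[of fst]) (auto simp: inj_on_def)
  then have "card {p\<in>Q. snd p = k} < k" using k by simp
  then have "prefactor Q k < int k"
    unfolding prefactor_eq_card[OF finite_tourn[OF Q]] using k by (auto simp: ratio_apply)
  ultimately show False by simp
qed

theorem theorem2:
  fixes n :: nat and a :: "nat \<Rightarrow> nat" and Q2 :: "(nat \<times> nat) set"
  assumes "n \<ge> 3"
    and "Q2 \<subseteq> {(i, j). 3 \<le> i \<and> i < j \<and> j \<le> n}"
  defines "F \<equiv> lmul (lmono (\<lambda>k. ratio 0 2 k + (\<Sum>p\<in>Q2. ratio (snd p) (fst p) k))) (Dn n a)"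
  shows "(\<not> transitive_tourn n Q2 \<longrightarrow> CT F = 0)
    \<and> (\<forall>\<sigma>. transitive_tourn n Q2 \<and> winner_perm n Q2 \<sigma> \<longrightarrow>
         CT F = (-1) ^ card Q2
           * ((1 + qK ^ a (\<sigma> 1)) * (qK ^ a (\<sigma> 2) - qK ^ a (\<sigma> 3))
              / (1 - qK ^ (a 0 + a (\<sigma> 1) + a (\<sigma> 3))))
           * (qfac (\<Sum>i\<le>n. a i) / (\<Prod>i\<le>n. qfac (a i)))
           * (\<Prod>i=1..n. (1 - qK ^ a i) / (1 - qK ^ (a 0 + (\<Sum>k=1..i. a (\<sigma> k))))))"
proof (cases "\<exists>k\<in>{1..n}. a k = 0")
  case True
  define Z where "Z = {k\<in>{1..n}. a k = 0}"
  have Z: "finite Z" "Z \<noteq> {}" using True by (auto simp: Z_def)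
  define k where "k = Max Z"
  have "k \<in> Z" using Max_in[OF Z] by (simp add: k_def)
  then have k: "1 \<le> k" "k \<le> n" "a k = 0" by (auto simp: Z_def)
  have "1 \<le> a j" if "k < j" "j \<le> n" for j
  proof (rule ccontr)
    assume "\<not> 1 \<le> a j"
    then have "j \<in> Z" using that k by (auto simp: Z_def)
    then show False using Max_ge[OF Z(1), of j] that by (simp add: k_def)
  qed
  then have "CT F = 0"
    using CT_zero_param[of Q2 n k a, OF assms(2) k] unfolding F_def prefactor_def[abs_def] by blast
  \<comment> \<open>The factor with i = k has numerator 1 - q ^ 0 = 0. Other denominators may be 0
    as well, as when all parameters vanish; with x / 0 = 0 the product is still 0.\<close>
  moreover have "(\<Prod>i=1..n. (1 - qK ^ a i) / (1 - qK ^ (a 0 + (\<Sum>k=1..i. a (\<sigma> k))))) = 0" for \<sigma>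
    using k by (intro prod_zero bexI[of _ k]) auto
  ultimately show ?thesis by simp
next
  case False
  interpret T: dyson_tournament n a Q2
    using assms(1,2) False by unfold_locales (auto simp: Suc_le_eq)
  have F: "F = T.F"
    unfolding F_def T.F_def prefactor_def[abs_def] ..
  show ?thesis
  proof (intro conjI impI allI, goal_cases)
    case 1
    then show ?case unfolding F by (rule T.CT_nontransitive)
  next
    case (2 \<sigma>)
    interpret T: dyson_transitive n a Q2 \<sigma>
      using 2 by unfold_locales auto
    show ?case unfolding F by (rule T.CT_transitive)
  qed
qed

end
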